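(* Each complete, algebraic, degenerate (space-like) stationary surface in $\mathbb{R}^{3,1}$ of parabolic type is an entire graph over a light-like plane.
   Context: $\mathbb{R}^{3,1}$ is $\mathbb{R}^4$ with the Minkowski inner product $\langle u,v\rangle=u_1v_1+u_2v_2+u_3v_3-u_4v_4$, extended complex-bilinearly to $\mathbb{C}^4$. A space-like surface is a connected oriented surface with an immersion $\mathbf{x}:M\to\mathbb{R}^{3,1}$ whose induced metric is positive definite; it is stationary if its mean curvature vector field vanishes identically, complete if the induced metric is complete. With local complex coordinate $z=u+iv$ from oriented isothermal parameters, the Gauss map is $p\mapsto[\mathbf{x}_z]\in Q_{1,1}=\{[z]\in\mathbb{CP}^3:\langle z,z\rangle=0\}$, and $\phi=\mathbf{x}_z\,dz$ is a globally defined $\mathbb{C}^4$-valued holomorphic $1$-form. For $[A]\in\mathbb{CP}^3$, $H_A=\{[z]\in Q_{1,1}:\langle A,z\rangle=0\}$. $M$ is a degenerate stationary surface of parabolic type if its Gauss image lies in some $H_A$ such that $\mathrm{Re}\,A,\mathrm{Im}\,A$ are linearly independent and span a light-like $2$-plane (induced inner product degenerate). $M$ is algebraic if it is conformally equivalent to $\bar M\setminus\{p_1,\dots,p_m\}$ with $\bar M$ a compact Riemann surface and $\phi$ extends to a meromorphic form on $\bar M$. $M$ is an entire graph over a light-like plane if, after an isometry of $\mathbb{R}^{3,1}$, it is of the form $\{(u_1,F_1(u_1,u_2),u_2+F_2(u_1,u_2),u_2-F_2(u_1,u_2)):(u_1,u_2)\in\mathbb{R}^2\}$, i.e. the graph of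 a function from $\mathbb{R}\varepsilon_1\oplus\mathbb{R}(\varepsilon_3+\varepsilon_4)$ to $\mathbb{R}\varepsilon_2\oplus\mathbb{R}(\varepsilon_3-\varepsilon_4)$, where $\varepsilon_1,\dots,\varepsilon_4$ is the standard basis. *)

theory Defs
  imports "HOL-Complex_Analysis.Complex_Analysis"
begin

section \<open>Minkowski space\<close>

text \<open>On \<open>real ^ 4\<close> this is the Minkowski inner product, on \<open>complex ^ 4\<close> its
  complex-bilinear (not sesquilinear) extension.\<close>

definition lorentz :: "'k::comm_ring_1 ^ 4 \<Rightarrow> 'k ^ 4 \<Rightarrow> 'k" where
  "lorentz u v = u $ 1 * v $ 1 + u $ 2 * v $ 2 + u $ 3 * v $ 3 - u $ 4 * v $ 4"

definition lorentz_isometry :: "(real ^ 4 \<Rightarrow> real ^ 4) \<Rightarrow> bool" where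
  "lorentz_isometry T \<longleftrightarrow>
     (\<exists>L b. linear L \<and> (\<forall>u v. lorentz (L u) (L v) = lorentz u v) \<and> (\<forall>u. T u = L u + b))"

definition lightlike_plane :: "(real ^ 4) set \<Rightarrow> bool" where
  "lightlike_plane L \<longleftrightarrow>
     subspace L \<and> dim L = 2 \<and> (\<exists>w\<in>L. w \<noteq> 0 \<and> (\<forall>v\<in>L. lorentz w v = 0))"

definition Re_vec :: "complex ^ 4 \<Rightarrow> real ^ 4" where
  "Re_vec A = (\<chi> i. Re (A $ i))"

definition Im_vec :: "complex ^ 4 \<Rightarrow> real ^ 4" where
  "Im_vec A = (\<chi> i. Im (A $ i))"

text \<open>A point \<open>[z]\<close> of complex projective 3-space is the complex line \<open>vec.span {z}\<close>.\<close>

definition quadric_Q11 :: "(complex ^ 4) set set" where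
  "quadric_Q11 = {vec.span {z} | z. z \<noteq> 0 \<and> lorentz z z = 0}"

definition quadric_section :: "complex ^ 4 \<Rightarrow> (complex ^ 4) set set" where
  "quadric_section A = {l \<in> quadric_Q11. \<forall>z\<in>l. lorentz A z = 0}"


section \<open>Smooth functions on open subsets of the plane\<close>

text \<open>The coordinate plane with coordinates \<open>(u, v)\<close> is identified with \<open>complex\<close>
  via \<open>z = u + \<i> v\<close>.\<close>

definition partial_u :: "(complex \<Rightarrow> 'b::real_normed_vector) \<Rightarrow> complex \<Rightarrow> 'b" where
  "partial_u f z = frechet_derivative f (at z) 1"

definition partial_v :: "(complex \<Rightarrow> 'b::real_normed_vector) \<Rightarrow> complex \<Rightarrow> 'b" where
  "partial_v f z = frechet_derivative f (at z) \<i>"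

primrec Ck_on :: "nat \<Rightarrow> (complex \<Rightarrow> 'b::real_normed_vector) \<Rightarrow> complex set \<Rightarrow> bool" where
  "Ck_on 0 f S \<longleftrightarrow> continuous_on S f"
| "Ck_on (Suc k) f S \<longleftrightarrow>
     (\<forall>z\<in>S. f differentiable (at z)) \<and> Ck_on k (partial_u f) S \<and> Ck_on k (partial_v f) S"

definition smooth_on_plane :: "(complex \<Rightarrow> 'b::real_normed_vector) \<Rightarrow> complex set \<Rightarrow> bool" where
  "smooth_on_plane f S \<longleftrightarrow> (\<forall>k. Ck_on k f S)"


section \<open>Oriented smooth surfaces and Riemann surfaces\<close>

text \<open>A chart is a pair of a domain and a coordinate function; values of the coordinate
  outside the domain are irrelevant. Atlases need not be maximal.\<close>

type_synonym 'a chart = "'a set \<times> ('a \<Rightarrow> complex)"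

record 'a surface =
  topo :: "'a topology"
  atlas :: "'a chart set"

definition chart_image :: "'a chart \<Rightarrow> complex set" where
  "chart_image c = snd c ` fst c"

definition in_chart :: "('a \<Rightarrow> 'b) \<Rightarrow> 'a chart \<Rightarrow> complex \<Rightarrow> 'b" where
  "in_chart f c = (\<lambda>\<zeta>. f (inv_into (fst c) (snd c) \<zeta>))"

definition topological_chart :: "'a topology \<Rightarrow> 'a chart \<Rightarrow> bool" where
  "topological_chart X c \<longleftrightarrow>
     openin X (fst c) \<and> open (chart_image c) \<and>
     homeomorphic_map (subtopology X (fst c)) (top_of_set (chart_image c)) (snd c)"

definition topological_surface :: "'a surface \<Rightarrow> bool" where
  "topological_surface S \<longleftrightarrow>
     topspace (topo S) \<noteq> {} \<and> connected_space (topo S) \<and>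
     Hausdorff_space (topo S) \<and> second_countable (topo S) \<and>
     (\<forall>c\<in>atlas S. topological_chart (topo S) c) \<and>
     (\<Union>c\<in>atlas S. fst c) = topspace (topo S)"

text \<open>The transition map from \<open>c\<close> to \<open>c'\<close> is defined on \<open>overlap c c'\<close>.\<close>

definition overlap :: "'a chart \<Rightarrow> 'a chart \<Rightarrow> complex set" where
  "overlap c c' = snd c ` (fst c \<inter> fst c')"

definition transition :: "'a chart \<Rightarrow> 'a chart \<Rightarrow> complex \<Rightarrow> complex" where
  "transition c c' = in_chart (snd c') c"

text \<open>\<open>Im (cnj a * b)\<close> is the determinant of the real matrix with columns \<open>a\<close> and \<open>b\<close>,
  so the second condition says that the Jacobian determinant is positive.\<close>

definition oriented_smooth_transition :: "'a chart \<Rightarrow> 'a chart \<Rightarrow> bool" where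
  "oriented_smooth_transition c c' \<longleftrightarrow>
     smooth_on_plane (transition c c') (overlap c c') \<and>
     (\<forall>\<zeta>\<in>overlap c c'.
        Im (cnj (partial_u (transition c c') \<zeta>) * partial_v (transition c c') \<zeta>) > 0)"

definition oriented_smooth_surface :: "'a surface \<Rightarrow> bool" where
  "oriented_smooth_surface S \<longleftrightarrow>
     topological_surface S \<and>
     (\<forall>c\<in>atlas S. \<forall>c'\<in>atlas S. oriented_smooth_transition c c')"

definition riemann_surface :: "'a surface \<Rightarrow> bool" where
  "riemann_surface S \<longleftrightarrow>
     topological_surface S \<and>
     (\<forall>c\<in>atlas S. \<forall>c'\<in>atlas S. transition c c' holomorphic_on overlap c c')"

definition compact_riemann_surface :: "'a surface \<Rightarrow> bool" where
  "compact_riemann_surface S \<longleftrightarrow> riemann_surface S \<and> compact_space (topo S)"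

text \<open>A \<open>\<complex>\<^sup>4\<close>-valued meromorphic 1-form is given by its coefficient \<open>\<omega> c\<close> with respect to
  each chart \<open>c\<close>. The values of a meromorphic function at its poles carry no
  information, so the transformation law is only imposed on punctured neighbourhoods.\<close>

definition meromorphic_form :: "'a surface \<Rightarrow> ('a chart \<Rightarrow> complex \<Rightarrow> complex ^ 4) \<Rightarrow> bool" where
  "meromorphic_form S \<omega> \<longleftrightarrow>
     (\<forall>c\<in>atlas S. \<forall>i. (\<lambda>\<zeta>. \<omega> c \<zeta> $ i) meromorphic_on chart_image c) \<and>
     (\<forall>c\<in>atlas S. \<forall>c'\<in>atlas S. \<forall>\<zeta>\<in>overlap c c'.
        \<forall>\<^sub>F \<xi> in at \<zeta>. \<omega> c \<xi> = deriv (transition c c') \<xi> *s \<omega> c' (transition c c' \<xi>))"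


section \<open>Space-like surfaces in Minkowski space\<close>

text \<open>Coefficients of the first fundamental form of a parametrization \<open>f\<close>.\<close>

definition form_E :: "(complex \<Rightarrow> real ^ 4) \<Rightarrow> complex \<Rightarrow> real" where
  "form_E f \<zeta> = lorentz (partial_u f \<zeta>) (partial_u f \<zeta>)"

definition form_F :: "(complex \<Rightarrow> real ^ 4) \<Rightarrow> complex \<Rightarrow> real" where
  "form_F f \<zeta> = lorentz (partial_u f \<zeta>) (partial_v f \<zeta>)"

definition form_G :: "(complex \<Rightarrow> real ^ 4) \<Rightarrow> complex \<Rightarrow> real" where
  "form_G f \<zeta> = lorentz (partial_v f \<zeta>) (partial_v f \<zeta>)"

text \<open>Positive definiteness of the induced metric makes the differential injective, so
  that \<open>x\<close> is an immersion.\<close>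

definition spacelike_surface :: "'a surface \<Rightarrow> ('a \<Rightarrow> real ^ 4) \<Rightarrow> bool" where
  "spacelike_surface M x \<longleftrightarrow>
     oriented_smooth_surface M \<and>
     (\<forall>c\<in>atlas M. smooth_on_plane (in_chart x c) (chart_image c) \<and>
       (\<forall>\<zeta>\<in>chart_image c. \<forall>a b :: real. (a, b) \<noteq> (0, 0) \<longrightarrow>
          (let w = a *\<^sub>R partial_u (in_chart x c) \<zeta> + b *\<^sub>R partial_v (in_chart x c) \<zeta>
           in lorentz w w > 0)))"

text \<open>Component of \<open>w\<close> orthogonal to the tangent plane of the parametrization \<open>f\<close> at \<open>\<zeta>\<close>.\<close>

definition normal_part :: "(complex \<Rightarrow> real ^ 4) \<Rightarrow> complex \<Rightarrow> real ^ 4 \<Rightarrow> real ^ 4" where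
  "normal_part f \<zeta> w =
     (let E = form_E f \<zeta>; F = form_F f \<zeta>; G = form_G f \<zeta>; D = E * G - F\<^sup>2;
          p = lorentz w (partial_u f \<zeta>); q = lorentz w (partial_v f \<zeta>)
      in w - ((G * p - F * q) / D) *\<^sub>R partial_u f \<zeta> - ((E * q - F * p) / D) *\<^sub>R partial_v f \<zeta>)"

text \<open>Half the trace, with respect to the induced metric, of the vector-valued second
  fundamental form (the normal part of the second derivatives).\<close>

definition mean_curvature_vector :: "(complex \<Rightarrow> real ^ 4) \<Rightarrow> complex \<Rightarrow> real ^ 4" where
  "mean_curvature_vector f \<zeta> =
     (let E = form_E f \<zeta>; F = form_F f \<zeta>; G = form_G f \<zeta>;
          II\<^sub>u\<^sub>u = normal_part f \<zeta> (partial_u (partial_u f) \<zeta>);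
          II\<^sub>u\<^sub>v = normal_part f \<zeta> (partial_u (partial_v f) \<zeta>);
          II\<^sub>v\<^sub>v = normal_part f \<zeta> (partial_v (partial_v f) \<zeta>)
      in (1 / (2 * (E * G - F\<^sup>2))) *\<^sub>R (G *\<^sub>R II\<^sub>u\<^sub>u - (2 * F) *\<^sub>R II\<^sub>u\<^sub>v + E *\<^sub>R II\<^sub>v\<^sub>v))"

definition stationary_surface :: "'a surface \<Rightarrow> ('a \<Rightarrow> real ^ 4) \<Rightarrow> bool" where
  "stationary_surface M x \<longleftrightarrow>
     spacelike_surface M x \<and>
     (\<forall>c\<in>atlas M. \<forall>\<zeta>\<in>chart_image c. mean_curvature_vector (in_chart x c) \<zeta> = 0)"


section \<open>Completeness of the induced metric\<close>

definition surface_path :: "'a surface \<Rightarrow> (real \<Rightarrow> 'a) \<Rightarrow> bool" where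
  "surface_path M \<gamma> \<longleftrightarrow>
     pathin (topo M) \<gamma> \<and>
     (\<forall>c\<in>atlas M. \<forall>a b. 0 \<le> a \<and> a \<le> b \<and> b \<le> 1 \<and> \<gamma> ` {a..b} \<subseteq> fst c \<longrightarrow>
        (snd c \<circ> \<gamma>) piecewise_C1_differentiable_on {a..b})"

text \<open>As the metric is induced by \<open>x\<close>, the squared speed of \<open>\<gamma>\<close> is the Lorentz square of
  the velocity of \<open>x \<circ> \<gamma>\<close>.\<close>

definition path_length :: "('a \<Rightarrow> real ^ 4) \<Rightarrow> (real \<Rightarrow> 'a) \<Rightarrow> ennreal" where
  "path_length x \<gamma> =
     (\<integral>\<^sup>+t\<in>{0..1}. ennreal (sqrt (lorentz (vector_derivative (x \<circ> \<gamma>) (at t))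
                                        (vector_derivative (x \<circ> \<gamma>) (at t)))) \<partial>lborel)"

definition induced_dist :: "'a surface \<Rightarrow> ('a \<Rightarrow> real ^ 4) \<Rightarrow> 'a \<Rightarrow> 'a \<Rightarrow> ennreal" where
  "induced_dist M x p q =
     (INF \<gamma> \<in> {\<gamma>. surface_path M \<gamma> \<and> \<gamma> 0 = p \<and> \<gamma> 1 = q}. path_length x \<gamma>)"

definition complete_surface :: "'a surface \<Rightarrow> ('a \<Rightarrow> real ^ 4) \<Rightarrow> bool" where
  "complete_surface M x \<longleftrightarrow>
     (\<forall>s :: nat \<Rightarrow> 'a. range s \<subseteq> topspace (topo M) \<and>
        (\<forall>e>0. \<exists>N. \<forall>m\<ge>N. \<forall>n\<ge>N. induced_dist M x (s m) (s n) < e) \<longrightarrow>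
        (\<exists>p\<in>topspace (topo M). (\<lambda>n. induced_dist M x (s n) p) \<longlonglongrightarrow> 0))"


section \<open>Isothermal parameters, Gauss map, degenerate and algebraic surfaces\<close>

definition isothermal_chart :: "'a surface \<Rightarrow> ('a \<Rightarrow> real ^ 4) \<Rightarrow> 'a chart \<Rightarrow> bool" where
  "isothermal_chart M x c \<longleftrightarrow>
     topological_chart (topo M) c \<and>
     (\<forall>c'\<in>atlas M. oriented_smooth_transition c c' \<and> oriented_smooth_transition c' c) \<and>
     (\<forall>\<zeta>\<in>chart_image c. form_E (in_chart x c) \<zeta> = form_G (in_chart x c) \<zeta> \<and>
                        form_F (in_chart x c) \<zeta> = 0)"

text \<open>\<open>x\<^sub>z = (x\<^sub>u - \<i> x\<^sub>v) / 2\<close>, the coefficient of the form \<open>\<phi> = x\<^sub>z dz\<close> in the chart \<open>c\<close>.\<close>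

definition phi_coeff :: "('a \<Rightarrow> real ^ 4) \<Rightarrow> 'a chart \<Rightarrow> complex \<Rightarrow> complex ^ 4" where
  "phi_coeff x c \<zeta> =
     (\<chi> i. (complex_of_real (partial_u (in_chart x c) \<zeta> $ i)
             - \<i> * complex_of_real (partial_v (in_chart x c) \<zeta> $ i)) / 2)"

definition gauss_image :: "'a surface \<Rightarrow> ('a \<Rightarrow> real ^ 4) \<Rightarrow> (complex ^ 4) set set" where
  "gauss_image M x =
     {vec.span {phi_coeff x c (snd c p)} | c p. isothermal_chart M x c \<and> p \<in> fst c}"

text \<open>The condition \<open>Re_vec A \<noteq> Im_vec A\<close> is part of linear independence of the pair, as
  \<open>{v, v}\<close> collapses to a singleton.\<close>

definition degenerate_parabolic :: "'a surface \<Rightarrow> ('a \<Rightarrow> real ^ 4) \<Rightarrow> bool" where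
  "degenerate_parabolic M x \<longleftrightarrow>
     (\<exists>A. Re_vec A \<noteq> Im_vec A \<and> independent {Re_vec A, Im_vec A} \<and>
          lightlike_plane (span {Re_vec A, Im_vec A}) \<and>
          gauss_image M x \<subseteq> quadric_section A)"

text \<open>The chart \<open>c\<close> of a surface \<open>N\<close>, restricted to the complement of \<open>P\<close> and transported
  along \<open>\<psi> : N - P \<rightarrow> M\<close>.\<close>

definition push_chart :: "'b surface \<Rightarrow> 'b set \<Rightarrow> ('b \<Rightarrow> 'a) \<Rightarrow> 'b chart \<Rightarrow> 'a chart" where
  "push_chart N P \<psi> c =
     (\<psi> ` (fst c - P), \<lambda>q. snd c (inv_into (topspace (topo N) - P) \<psi> q))"

text \<open>\<open>\<psi>\<close> is a conformal equivalence from the punctured Riemann surface onto \<open>M\<close>: a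
  homeomorphism transporting holomorphic coordinates to oriented isothermal parameters.\<close>

definition conformal_equivalence ::
    "'b surface \<Rightarrow> 'b set \<Rightarrow> ('b \<Rightarrow> 'a) \<Rightarrow> 'a surface \<Rightarrow> ('a \<Rightarrow> real ^ 4) \<Rightarrow> bool" where
  "conformal_equivalence N P \<psi> M x \<longleftrightarrow>
     homeomorphic_map (subtopology (topo N) (topspace (topo N) - P)) (topo M) \<psi> \<and>
     (\<forall>c\<in>atlas N. isothermal_chart M x (push_chart N P \<psi> c))"

text \<open>HOL cannot quantify over the type of points of the compact Riemann surface inside a
  formula; it is therefore passed as an argument.\<close>

definition algebraic_surface :: "'b itself \<Rightarrow> 'a surface \<Rightarrow> ('a \<Rightarrow> real ^ 4) \<Rightarrow> bool" where
  "algebraic_surface TB M x \<longleftrightarrow>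
     (\<exists>(N :: 'b surface) P \<psi> \<omega>.
        compact_riemann_surface N \<and> finite P \<and> P \<subseteq> topspace (topo N) \<and>
        conformal_equivalence N P \<psi> M x \<and>
        meromorphic_form N \<omega> \<and>
        (\<forall>c\<in>atlas N. \<forall>\<zeta>\<in>snd c ` (fst c - P). \<omega> c \<zeta> = phi_coeff x (push_chart N P \<psi> c) \<zeta>))"

definition entire_graph_lightlike :: "'a surface \<Rightarrow> ('a \<Rightarrow> real ^ 4) \<Rightarrow> bool" where
  "entire_graph_lightlike M x \<longleftrightarrow>
     (\<exists>T. lorentz_isometry T \<and>
       (\<exists>F\<^sub>1 F\<^sub>2 :: real \<Rightarrow> real \<Rightarrow> real.
          bij_betw (T \<circ> x) (topspace (topo M))
            {vector [u\<^sub>1, F\<^sub>1 u\<^sub>1 u\<^sub>2, u\<^sub>2 + F\<^sub>2 u\<^sub>1 u\<^sub>2, u\<^sub>2 - F\<^sub>2 u\<^sub>1 u\<^sub>2] | u\<^sub>1 u\<^sub>2. True}))"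

end

theory Submission
  imports Defs
begin

text \<open>After a Lorentz isometry the light-like plane spanned by \<open>Re A\<close> and \<open>Im A\<close> is
  \<open>\<real>\<epsilon>\<^sub>1 \<oplus> \<real>(\<epsilon>\<^sub>3 - \<epsilon>\<^sub>4)\<close>, and the hypothesis \<open>\<langle>A, \<phi>\<rangle> = 0\<close> becomes \<open>\<phi>\<^sub>1 = c h\<close> with \<open>h = \<phi>\<^sub>3 + \<phi>\<^sub>4\<close> and
  \<open>c\<close> not real. With \<open>g = \<phi>\<^sub>2 / h\<close>, nullity of \<open>\<phi>\<close> turns the metric into a multiple of
  \<open>\<bar>h\<bar>\<^sup>2 ((Im c)\<^sup>2 + (Im g)\<^sup>2) \<bar>dz\<bar>\<^sup>2\<close>, so \<open>h\<close> has no zeros. As the real parts of \<open>\<integral>h\<close> and \<open>\<integral>c h\<close> are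
  coordinates of the surface, \<open>H = \<integral>h\<close> is a globally defined local biholomorphism to \<open>\<complex>\<close>, and the
  claim is that it is bijective. At a puncture \<open>H\<close> has at most a pole because \<open>h\<close> is meromorphic.
  If it had no pole, then \<open>h\<close> would be bounded there and a curve into the puncture along which \<open>g\<close>
  is essentially real would have finite length, contradicting completeness. Hence \<open>H\<close> tends to
  infinity at all punctures, so it is a proper local homeomorphism onto the simply connected plane.\<close>

text \<open>\<open>H\<close> has no period problem: it is a fixed real-linear function of the
  position vector, and degeneracy makes it satisfy the Cauchy-Riemann equations in every isothermal
  chart. Its real and imaginary parts are, up to an invertible linear change, the coordinates
  \<open>u1\<close>, \<open>u2\<close> of the target plane, so bijectivity of \<open>H\<close> is
  exactly the graph property. The obstacle at a puncture is the factor \<open>(Im g)^2\<close> of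
  the metric: \<open>g\<close> may have a pole where \<open>h\<close> stays bounded, so not every
  curve into the puncture is short. Moreover, completeness speaks of limits for
  \<open>induced_dist\<close>. To contradict it one also needs the converse estimate that leaving a
  coordinate disc costs a fixed length, so that an intrinsic limit is a topological limit. For the
  last step, properness yields one radius for local inverses over each bounded set. They are
  continued outward over balls about one base value, where convexity keeps all intersections
  connected and the continuation unambiguous.\<close>

no_notation fps_nth (infixl "$" 75)

section \<open>Lorentz geometry of light-like planes\<close>

text \<open>Isothermality says that the complex vector with real part \<open>a\<close> and imaginary
  part \<open>- b\<close> is null: \<open>(c h)^2 + p^2 + h k = 0\<close>, where \<open>k\<close> is
  the difference of components 3 and 4. Dividing by \<open>h\<close> expresses \<open>k\<close>
  through \<open>c\<close>, \<open>g = p / h\<close> and \<open>h\<close>, and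
  \<open>|z|^2 - Re (z^2) = 2 (Im z)^2\<close> leaves only imaginary parts. If \<open>h\<close>
  vanished, so would \<open>p\<close>, and with them the metric.\<close>

lemma parabolic_pointwise:
  fixes a b :: "real ^ 4" and c :: complex
  defines "h \<equiv> Complex (a$3 + a$4) (- (b$3 + b$4))" and "p \<equiv> Complex (a$2) (- (b$2))"
  assumes ab: "lorentz a a = lorentz b b" "lorentz a b = 0" and pos: "lorentz a a > 0"
    and deg: "Complex (a$1) (- (b$1)) = c * h"
  shows "h \<noteq> 0" and "lorentz a a = (cmod h)\<^sup>2 * ((Im c)\<^sup>2 + (Im (p / h))\<^sup>2)"
proof -
  define k where "k = Complex (a$3 - a$4) (- (b$3 - b$4))"
  have a1: "a$1 = Re (c * h)" and b1: "b$1 = - Im (c * h)"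
    using deg by (metis complex.sel(1), metis complex.sel(2) minus_minus)
  have null: "(c * h)\<^sup>2 + p\<^sup>2 + h * k = 0"
    unfolding deg[symmetric] using ab
    by (simp add: complex_eq_iff h_def p_def k_def lorentz_def power2_eq_square algebra_simps)
  have norm: "2 * lorentz a a = (cmod (c * h))\<^sup>2 + (cmod p)\<^sup>2 + Re (h * cnj k)"
    unfolding deg[symmetric] using ab
    by (simp add: h_def p_def k_def lorentz_def cmod_power2) (simp add: power2_eq_square algebra_simps)
  show h0: "h \<noteq> 0"
  proof
    assume h: "h = 0"
    with null have "p = 0" by simp
    with h norm pos show False by simp
  qed
  define g where "g = p / h"
  have p: "p = g * h" using h0 by (simp add: g_def)
  have "h * (c\<^sup>2 * h + g\<^sup>2 * h + k) = 0"
    using null unfolding p by (simp add: power2_eq_square algebra_simps)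
  then have "c\<^sup>2 * h + g\<^sup>2 * h + k = 0" using h0 by simp
  then have k: "k = - (c\<^sup>2 + g\<^sup>2) * h" by (simp add: algebra_simps eq_neg_iff_add_eq_0)
  have "Re (h * cnj k) = - (cmod h)\<^sup>2 * Re (c\<^sup>2 + g\<^sup>2)"
    by (simp add: k cmod_power2) (simp add: power2_eq_square algebra_simps)
  have "(cmod z)\<^sup>2 - Re (z\<^sup>2) = 2 * (Im z)\<^sup>2" for z
    unfolding cmod_power2 by (simp add: power2_eq_square)
  from this[of c] this[of g]
  have "(cmod c)\<^sup>2 + (cmod g)\<^sup>2 - Re (c\<^sup>2 + g\<^sup>2) = 2 * ((Im c)\<^sup>2 + (Im g)\<^sup>2)" by simp
  moreover have "2 * lorentz a a = (cmod h)\<^sup>2 * ((cmod c)\<^sup>2 + (cmod g)\<^sup>2 - Re (c\<^sup>2 + g\<^sup>2))"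
    unfolding norm p norm_mult power_mult_distrib \<open>Re (h * cnj k) = _\<close> by (simp only: algebra_simps)
  ultimately have "2 * lorentz a a = (cmod h)\<^sup>2 * (2 * ((Im c)\<^sup>2 + (Im g)\<^sup>2))" by simp
  then show "lorentz a a = (cmod h)\<^sup>2 * ((Im c)\<^sup>2 + (Im (p / h))\<^sup>2)" unfolding g_def by linarith
qed

lemma vector_4:
  "(vector [w, x, y, z] :: 'a::zero ^ 4) $ 1 = w" "(vector [w, x, y, z] :: 'a ^ 4) $ 2 = x"
  "(vector [w, x, y, z] :: 'a ^ 4) $ 3 = y" "(vector [w, x, y, z] :: 'a ^ 4) $ 4 = z"
proof -
  have 1: "(1::4) + 1 = 2" "(2::4) + 1 = 3" "(3::4) + 1 = 4" by simp_all
  have 2: "(1::4) \<noteq> 2" "(1::4) \<noteq> 3" "(1::4) \<noteq> 4" "(2::4) \<noteq> 3" "(2::4) \<noteq> 4" "(3::4) \<noteq> 4" by simp_all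
  show   "(vector [w, x, y, z] :: 'a::zero ^ 4) $ 1 = w" "(vector [w, x, y, z] :: 'a ^ 4) $ 2 = x"
  "(vector [w, x, y, z] :: 'a ^ 4) $ 3 = y" "(vector [w, x, y, z] :: 'a ^ 4) $ 4 = z"
    by (simp_all only: vector_def vec_lambda_beta foldr.simps o_apply fun_upd_def 1 2 2[THEN not_sym] if_True if_False simp_thms)
qed

lemma null_vector_fourth_nonzero:
  fixes w :: "real ^ 4"
  assumes "lorentz w w = 0" "w \<noteq> 0"
  shows "w $ 4 \<noteq> 0"
proof
  assume "w $ 4 = 0"
  with assms(1) have "(w$1)\<^sup>2 + (w$2)\<^sup>2 + (w$3)\<^sup>2 = 0" by (simp add: lorentz_def power2_eq_square)
  then have "w$1 = 0 \<and> w$2 = 0 \<and> w$3 = 0"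
    by (smt (verit) zero_le_power2 power_eq_0_iff)
  with \<open>w $ 4 = 0\<close> \<open>w \<noteq> 0\<close> show False by (simp add: vec_eq_iff forall_4)
qed

text \<open>The vectors \<open>m\<close>, \<open>cross3 n m\<close>, \<open>n\<close> are the rows
  of an orthogonal matrix. This makes the explicit map \<open>L\<close> of
  \<open>lightlike_frame\<close> an isometry.\<close>

lemma orthonormal_frame_parseval:
  fixes m n u v :: "real ^ 3"
  assumes "m \<bullet> m = 1" "n \<bullet> n = 1" "m \<bullet> n = 0"
  shows "(m \<bullet> u) * (m \<bullet> v) + (cross3 n m \<bullet> u) * (cross3 n m \<bullet> v) + (n \<bullet> u) * (n \<bullet> v) = u \<bullet> v"
proof -
  define Q :: "real^3^3" where "Q = vector [m, cross3 n m, n]"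
  have k: "cross3 n m \<bullet> cross3 n m = 1"
    using assms by (simp add: dot_cross inner_commute)
  have "orthogonal_matrix Q"
    unfolding orthogonal_matrix_orthonormal_rows
    using assms k
    by (simp add: Q_def row_def forall_3 orthogonal_def norm_eq_1 inner_commute dot_cross_self)
  then have "(Q *v u) \<bullet> (Q *v v) = u \<bullet> v"
    by (metis orthogonal_transformation_def orthogonal_transformation_matrix
        matrix_of_matrix_vector_mul matrix_vector_mul_linear)
  moreover have "(Q *v u) \<bullet> (Q *v v) = (m \<bullet> u) * (m \<bullet> v) + (cross3 n m \<bullet> u) * (cross3 n m \<bullet> v) + (n \<bullet> u) * (n \<bullet> v)"
    by (simp add: inner_vec_def sum_3 Q_def matrix_vector_mul_component row_def)
  ultimately show ?thesis by simp
qed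

definition spatial :: "real ^ 4 \<Rightarrow> real ^ 3" where
  "spatial u = vector [u$1, u$2, u$3]"

lemma linear_spatial: "linear spatial"
  by (rule linearI) (simp_all add: spatial_def vec_eq_iff forall_3)

lemma spatial_inner: "spatial u \<bullet> spatial v = lorentz u v + u$4 * v$4"
  by (simp add: spatial_def inner_vec_def sum_3 lorentz_def)

text \<open>The radical of the plane contains a nonzero null vector. Scaled to time coordinate 1 it
  has a unit spatial part \<open>n\<close>, and modulo it the plane is a line spanned by a spatial
  unit vector \<open>m\<close> orthogonal to \<open>n\<close>. In the frame \<open>m\<close>,
  \<open>cross3 n m\<close>, \<open>n\<close> and reversed time, pairing with \<open>A\<close>
  involves only component 1 and the sum of components 3 and 4.\<close>

lemma lightlike_frame:
  assumes neq: "Re_vec A \<noteq> Im_vec A" and indep: "independent {Re_vec A, Im_vec A}"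
    and light: "lightlike_plane (span {Re_vec A, Im_vec A})"
  obtains L c where "linear L" "\<And>u v. lorentz (L u) (L v) = lorentz u v" "Im c \<noteq> 0"
    "\<And>a b. lorentz A (\<chi> i. (complex_of_real (a$i) - \<i> * complex_of_real (b$i)) / 2) = 0
      \<Longrightarrow> Complex (L a $ 1) (- (L b $ 1)) = c * Complex (L a $ 3 + L a $ 4) (- (L b $ 3 + L b $ 4))"
proof -
  note sp = linear_add[OF linear_spatial] linear_diff[OF linear_spatial] linear_scale[OF linear_spatial]
  define R where "R = Re_vec A"
  define I where "I = Im_vec A"
  obtain w where w: "w \<in> span {R, I}" "w \<noteq> 0" "\<And>v. v \<in> span {R, I} \<Longrightarrow> lorentz w v = 0"
    using light unfolding lightlike_plane_def R_def I_def by blast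
  have w4: "w$4 \<noteq> 0" using null_vector_fourth_nonzero w by blast
  obtain s0 where "w - s0 *\<^sub>R R \<in> span {I}"
    using w(1) unfolding span_insert[of R "{I}"] by blast
  then obtain t0 where "w - s0 *\<^sub>R R = t0 *\<^sub>R I" by (auto simp: span_singleton)
  then have "w = s0 *\<^sub>R R + t0 *\<^sub>R I" by (simp add: diff_eq_eq add.commute)
  define s t where "s = s0 / w$4" and "t = t0 / w$4"
  define n' where "n' = s *\<^sub>R R + t *\<^sub>R I"
  have n'w: "n' = (1 / w$4) *\<^sub>R w"
    using \<open>w = s0 *\<^sub>R R + t0 *\<^sub>R I\<close> by (simp add: n'_def s_def t_def scaleR_add_right)
  have n'4: "n' $ 4 = 1" using w4 by (simp add: n'w)
  have orth: "lorentz n' v = 0" if "v \<in> span {R, I}" for v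
    using w(3)[OF that] by (simp add: n'w lorentz_def field_simps)
  have n'_span: "n' \<in> span {R, I}"
    unfolding n'_def by (intro span_add span_scale span_base) auto
  have unit: "s * R$4 + t * I$4 = 1" using n'4 by (simp add: n'_def)
  define n where "n = spatial n'"
  have nn: "n \<bullet> n = 1" using orth[OF n'_span] n'4 by (simp add: n_def spatial_inner)
  have nv: "n \<bullet> spatial v = v$4" if "v \<in> span {R, I}" for v
    using orth[OF that] n'4 by (simp add: n_def spatial_inner)
  \<comment> \<open>The multiple of \<open>n'\<close> that cancels the time coordinate is removed;
    orthogonality to the radical makes the remainders orthogonal to \<open>n\<close>.\<close>
  define R' I' where "R' = spatial R - R$4 *\<^sub>R n" and "I' = spatial I - I$4 *\<^sub>R n"
  have "n \<bullet> R' = 0" "n \<bullet> I' = 0"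
    using nv[of R] nv[of I] nn by (simp_all add: R'_def I'_def inner_diff_right span_base)
  have "s *\<^sub>R R' + t *\<^sub>R I' = n - (s * R$4 + t * I$4) *\<^sub>R n"
    by (simp add: R'_def I'_def n_def n'_def sp algebra_simps)
  then have rel: "s *\<^sub>R R' + t *\<^sub>R I' = 0" by (simp add: unit)
  \<comment> \<open>The relation \<open>rel\<close> makes the pair \<open>R'\<close>,
    \<open>I'\<close> proportional to \<open>t\<close>, \<open>- s\<close>; \<open>m0\<close> is the
    common direction. Were it zero, \<open>R\<close> and \<open>I\<close> would both be multiples of
    \<open>n'\<close>.\<close>
  define m0 where "m0 = t *\<^sub>R R' - s *\<^sub>R I'"
  define D where "D = s\<^sup>2 + t\<^sup>2"
  have "s \<noteq> 0 \<or> t \<noteq> 0" using unit by auto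
  then have D: "D > 0" by (auto simp: D_def sum_power2_gt_zero_iff)
  have "D *\<^sub>R R' = t *\<^sub>R m0 + s *\<^sub>R (s *\<^sub>R R' + t *\<^sub>R I')"
    "D *\<^sub>R I' = - s *\<^sub>R m0 + t *\<^sub>R (s *\<^sub>R R' + t *\<^sub>R I')"
    by (simp_all add: D_def m0_def power2_eq_square algebra_simps)
  then have DR: "D *\<^sub>R R' = t *\<^sub>R m0" and DI: "D *\<^sub>R I' = - s *\<^sub>R m0"
    by (simp_all add: rel)
  have m0: "m0 \<noteq> 0"
  proof
    assume "m0 = 0"
    then have "R' = 0" "I' = 0" using DR DI D by auto
    then have "spatial R = spatial (R$4 *\<^sub>R n')" "spatial I = spatial (I$4 *\<^sub>R n')"
      by (simp_all add: R'_def I'_def n_def sp)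
    then have RI: "R = R$4 *\<^sub>R n'" "I = I$4 *\<^sub>R n'"
      using n'4 by (simp_all add: spatial_def vec_eq_iff forall_3 forall_4)
    have *: "R \<notin> span {I}" "I \<notin> span {R}"
      using indep neq unfolding dependent_def R_def[symmetric] I_def[symmetric]
      by (auto simp: insert_Diff_if)
    show False
    proof (cases "I$4 = 0")
      case True
      then have "I = 0" using RI by simp
      then show ?thesis using *(2) span_zero by blast
    next
      case False
      then have "R = (R$4 / I$4) *\<^sub>R I" by (metis RI scaleR_scaleR nonzero_eq_divide_eq)
      then show ?thesis using *(1) by (metis span_base span_scale singletonI)
    qed
  qed
  define \<mu> where "\<mu> = norm m0 / D"
  define m where "m = (1 / norm m0) *\<^sub>R m0"
  have mu: "\<mu> > 0" using D m0 by (simp add: \<mu>_def)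
  have mm: "m \<bullet> m = 1" using m0 by (simp add: m_def power2_norm_eq_inner[symmetric] power2_eq_square)
  have mn: "m \<bullet> n = 0" using \<open>n \<bullet> R' = 0\<close> \<open>n \<bullet> I' = 0\<close>
    by (simp add: m_def m0_def inner_diff_left) (simp add: inner_commute)
  have "R' = (1/D) *\<^sub>R (D *\<^sub>R R')" "I' = (1/D) *\<^sub>R (D *\<^sub>R I')" using D by simp_all
  then have R': "R' = (t * \<mu>) *\<^sub>R m" and I': "I' = (- s * \<mu>) *\<^sub>R m"
    unfolding DR DI using m0 by (simp_all add: m_def \<mu>_def)
  have R: "spatial R = (t * \<mu>) *\<^sub>R m + R$4 *\<^sub>R n" and I: "spatial I = (- s * \<mu>) *\<^sub>R m + I$4 *\<^sub>R n"
    using R' I' unfolding R'_def I'_def by (simp_all add: algebra_simps)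
  \<comment> \<open>With the minus sign \<open>n'\<close> goes to \<open>(0, 0, 1, -1)\<close>, so
    pairing with \<open>n'\<close> gives the sum of components 3 and 4.\<close>
  define L :: "real^4 \<Rightarrow> real^4" where
    "L u = vector [m \<bullet> spatial u, cross3 n m \<bullet> spatial u, n \<bullet> spatial u, - (u$4)]" for u
  define \<alpha> \<beta> where "\<alpha> = Complex (t * \<mu>) (- s * \<mu>)" and "\<beta> = Complex (R$4) (I$4)"
  have \<alpha>0: "\<alpha> \<noteq> 0" using \<open>s \<noteq> 0 \<or> t \<noteq> 0\<close> mu by (auto simp: \<alpha>_def complex_eq_iff)
  have lR: "lorentz R a = t * \<mu> * (L a $ 1) + R$4 * (L a $ 3 + L a $ 4)"
    and lI: "lorentz I a = - s * \<mu> * (L a $ 1) + I$4 * (L a $ 3 + L a $ 4)" for a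
    using spatial_inner[of R a] spatial_inner[of I a] unfolding R I
    by (simp_all add: L_def vector_4 inner_add_left vector_4 algebra_simps)
  show ?thesis
  proof
    show "linear L"
      by (rule linearI) (simp_all add: L_def vector_4 vec_eq_iff forall_4 sp inner_add_right)
    show "lorentz (L u) (L v) = lorentz u v" for u v
      using orthonormal_frame_parseval[OF mm nn mn, of "spatial u" "spatial v"]
      by (simp add: spatial_inner) (simp add: L_def vector_4 lorentz_def)
    \<comment> \<open>The normalisation \<open>unit\<close> turns the imaginary part into
      \<open>\<mu> > 0\<close>, which is why the witness \<open>- \<beta> / \<alpha>\<close> for
      \<open>c\<close> is not real.\<close>
    have "\<beta> * cnj \<alpha> = Complex (t * \<mu> * R$4 - s * \<mu> * I$4) \<mu>"
    proof -
      have "\<beta> * cnj \<alpha> = Complex (t * \<mu> * R$4 - s * \<mu> * I$4) (\<mu> * (s * R$4 + t * I$4))"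
        by (simp add: \<alpha>_def \<beta>_def complex_eq_iff algebra_simps)
      then show ?thesis by (simp add: unit)
    qed
    moreover have "- \<beta> / \<alpha> = - (\<beta> * cnj \<alpha>) / (cmod \<alpha>)\<^sup>2"
      using \<alpha>0 by (simp add: complex_div_cnj[of "\<beta>"])
    ultimately have "Im (- \<beta> / \<alpha>) = - \<mu> / (cmod \<alpha>)\<^sup>2"
      by simp
    then show "Im (- \<beta> / \<alpha>) \<noteq> 0" using mu \<alpha>0 by simp
    fix a b :: "real^4"
    assume "lorentz A (\<chi> i. (complex_of_real (a$i) - \<i> * complex_of_real (b$i)) / 2) = 0"
    moreover have "2 * lorentz A (\<chi> i. (complex_of_real (a$i) - \<i> * complex_of_real (b$i)) / 2)
      = Complex (lorentz R a + lorentz I b) (lorentz I a - lorentz R b)"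
      by (simp add: lorentz_def R_def I_def Re_vec_def Im_vec_def complex_eq_iff field_simps)
    ultimately have "lorentz R a + lorentz I b = 0" "lorentz I a - lorentz R b = 0"
      by (simp_all add: complex_eq_iff)
    then have "\<alpha> * Complex (L a $ 1) (- (L b $ 1)) + \<beta> * Complex (L a $ 3 + L a $ 4) (- (L b $ 3 + L b $ 4)) = 0"
      unfolding lR lI \<alpha>_def \<beta>_def complex_eq_iff by (simp add: algebra_simps)
    then show "Complex (L a $ 1) (- (L b $ 1)) = - \<beta> / \<alpha> * Complex (L a $ 3 + L a $ 4) (- (L b $ 3 + L b $ 4))"
      using \<alpha>0 by (simp add: divide_simps add_eq_0_iff mult.commute)
  qed
qed

section \<open>Proper local homeomorphisms to a vector space\<close>

text \<open>The local homeomorphism property is encoded by a continuous inverse branch over a ball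
  together with a neighbourhood on which \<open>H\<close> is injective: the former is continued, the
  latter gives uniqueness.\<close>

locale proper_local_homeomorphism =
  fixes X :: "'a topology" and H :: "'a \<Rightarrow> 'b::real_normed_vector"
  assumes Hausdorff: "Hausdorff_space X"
    and connected: "connected_space X"
    and nonempty: "topspace X \<noteq> {}"
    and continuous: "continuous_map X euclidean H"
    and local_section: "\<And>q. q \<in> topspace X \<Longrightarrow>
      \<exists>V e \<sigma>. openin X V \<and> q \<in> V \<and> inj_on H V \<and> 0 < e \<and>
        continuous_map (top_of_set (ball (H q) e)) X \<sigma> \<and> (\<forall>w\<in>ball (H q) e. \<sigma> w \<in> V \<and> H (\<sigma> w) = w)"
    and proper: "\<And>R. compactin X {q \<in> topspace X. norm (H q) \<le> R}"
begin

definition section_on :: "'b set \<Rightarrow> ('b \<Rightarrow> 'a) \<Rightarrow> bool" where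
  "section_on T s \<longleftrightarrow> continuous_map (top_of_set T) X s \<and> (\<forall>w\<in>T. H (s w) = w)"

lemma section_on_topspace: "section_on T s \<Longrightarrow> w \<in> T \<Longrightarrow> s w \<in> topspace X"
  using continuous_map_image_subset_topspace unfolding section_on_def by fastforce

lemma section_on_subset: "section_on T s \<Longrightarrow> T' \<subseteq> T \<Longrightarrow> section_on T' s"
  unfolding section_on_def
  by (metis continuous_map_from_subtopology_mono subsetD)

text \<open>The set of agreement is closed because \<open>X\<close> is Hausdorff, and open because
  \<open>H\<close> is injective near each common value.\<close>

lemma section_unique:
  assumes s1: "section_on T s1" and s2: "section_on T s2" and T: "connected T"
    and w0: "w0 \<in> T" "s1 w0 = s2 w0" and w: "w \<in> T"
  shows "s1 w = s2 w"
proof -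
  let ?E = "{w \<in> topspace (top_of_set T). s1 w = s2 w}"
  have cl: "closedin (top_of_set T) ?E"
    using closedin_continuous_maps_eq Hausdorff s1 s2 unfolding section_on_def by blast
  have "openin (top_of_set T) ?E"
  proof (subst openin_subopen, intro ballI)
    fix u assume u: "u \<in> ?E"
    then have "s1 u \<in> topspace X" using section_on_topspace[OF s1, of u] by simp
    then obtain V where V: "openin X V" "s1 u \<in> V" "inj_on H V" using local_section by blast
    let ?W = "{w \<in> topspace (top_of_set T). s1 w \<in> V} \<inter> {w \<in> topspace (top_of_set T). s2 w \<in> V}"
    have "openin (top_of_set T) ?W"
      using s1 s2 V(1) unfolding section_on_def
      by (intro openin_Int openin_continuous_map_preimage[of _ X]) auto
    moreover have "u \<in> ?W" using u V(2) by auto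
    moreover have "?W \<subseteq> ?E"
    proof
      fix w assume w: "w \<in> ?W"
      then have "H (s1 w) = H (s2 w)" using s1 s2 by (simp add: section_on_def)
      then show "w \<in> ?E" using w V(3) by (auto dest: inj_onD)
    qed
    ultimately show "\<exists>W. openin (top_of_set T) W \<and> u \<in> W \<and> W \<subseteq> ?E" by blast
  qed
  moreover have "connected_space (top_of_set T)" using T by (simp add: connectedin_def flip: connectedin_iff_connected)
  ultimately have "?E = {} \<or> ?E = T" using cl unfolding connected_space_clopen_in by auto
  then show ?thesis using w0 w by auto
qed

text \<open>A Lebesgue number argument: every point has a neighbourhood with a common branch radius,
  and properness leaves finitely many radii to minimise over.\<close>

lemma uniform_section:
  obtains e where "e > 0"
    "\<And>q. q \<in> topspace X \<Longrightarrow> norm (H q) \<le> R \<Longrightarrow> \<exists>\<sigma>. section_on (ball (H q) e) \<sigma> \<and> \<sigma> (H q) = q"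
proof -
  let ?K = "{q \<in> topspace X. norm (H q) \<le> R}"
  define good where "good e q \<longleftrightarrow> (\<exists>\<sigma>. section_on (ball (H q) e) \<sigma> \<and> \<sigma> (H q) = q)" for e q
  have loc: "\<exists>U e. openin X U \<and> q \<in> U \<and> e > 0 \<and> (\<forall>q'\<in>U. good e q')" if q: "q \<in> topspace X" for q
  proof -
    obtain V e \<sigma> where V: "openin X V" "q \<in> V" "inj_on H V" "0 < e"
      and \<sigma>: "continuous_map (top_of_set (ball (H q) e)) X \<sigma>" "\<And>w. w \<in> ball (H q) e \<Longrightarrow> \<sigma> w \<in> V \<and> H (\<sigma> w) = w"
      using local_section[OF q] by blast
    have sec: "section_on (ball (H q) e) \<sigma>" using \<sigma> by (simp add: section_on_def)
    \<comment> \<open>Halving the radius lets the same branch serve all nearby \<open>q'\<close>,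
      since the half-size ball about \<open>H q'\<close> stays inside the full ball about
      \<open>H q\<close>.\<close>
    define U where "U = {q' \<in> topspace X. H q' \<in> ball (H q) (e/2)} \<inter> V"
    have "openin X U"
      unfolding U_def by (intro openin_Int openin_continuous_map_preimage[OF continuous] V(1)) simp
    moreover have "good (e/2) q'" if q': "q' \<in> U" for q'
    proof -
      have d: "dist (H q) (H q') < e / 2" and "q' \<in> V" using q' by (simp_all add: U_def)
      have "ball (H q') (e/2) \<subseteq> ball (H q) e"
      proof
        fix w assume "w \<in> ball (H q') (e/2)"
        then show "w \<in> ball (H q) e" using d dist_triangle[of "H q" w "H q'"] by simp
      qed
      then have "section_on (ball (H q') (e/2)) \<sigma>" using section_on_subset sec by blast
      moreover have "H q' \<in> ball (H q) e" using d V(4) by simp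
      then have "\<sigma> (H q') = q'" using \<sigma>(2) \<open>q' \<in> V\<close> inj_onD[OF V(3)] by blast
      ultimately show ?thesis unfolding good_def by blast
    qed
    moreover have "q \<in> U" "e/2 > 0" using q V by (simp_all add: U_def)
    ultimately show ?thesis by blast
  qed
  then obtain U e where U: "\<And>q. q \<in> topspace X \<Longrightarrow> openin X (U q) \<and> q \<in> U q \<and> e q > 0 \<and> (\<forall>q'\<in>U q. good (e q) q')"
    by metis
  have "\<forall>W \<in> U ` ?K. openin X W" "?K \<subseteq> \<Union>(U ` ?K)" using U by blast+
  then obtain \<F> where "finite \<F>" "\<F> \<subseteq> U ` ?K" "?K \<subseteq> \<Union>\<F>"
    using proper[of R] unfolding compactin_def by meson
  then obtain F where F: "finite F" "F \<subseteq> ?K" "?K \<subseteq> (\<Union>q\<in>F. U q)"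
    using finite_subset_image[of \<F> U ?K] by blast
  \<comment> \<open>The inserted 1 keeps the minimum meaningful if \<open>F\<close> is
    empty.\<close>
  define d where "d = Min (insert 1 (e ` F))"
  have "e q > 0" if "q \<in> F" for q using U F(2) that by blast
  then have "d > 0" using F(1) by (simp add: d_def)
  moreover have "good d q" if q: "q \<in> topspace X" "norm (H q) \<le> R" for q
  proof -
    obtain p where p: "p \<in> F" "q \<in> U p" using F(3) q by blast
    then obtain \<sigma> where \<sigma>: "section_on (ball (H q) (e p)) \<sigma>" "\<sigma> (H q) = q"
      using U F(2) unfolding good_def by blast
    have "d \<le> e p" using F(1) p(1) by (simp add: d_def)
    then have "section_on (ball (H q) d) \<sigma>" using \<sigma>(1) section_on_subset subset_ball by blast
    with \<sigma>(2) show ?thesis unfolding good_def by blast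
  qed
  ultimately show ?thesis using that unfolding good_def by blast
qed

text \<open>Each point of the larger ball is within \<open>e/4\<close> of its radial contraction
  into the old ball, where a branch of radius \<open>e\<close> that starts on \<open>s\<close> is
  available. The new section follows that branch.\<close>

lemma extend_section:
  assumes s: "section_on (ball (H p) r) s" "s (H p) = p" and r: "r > 0" and e: "e > 0"
    and sec: "\<And>q. q \<in> topspace X \<Longrightarrow> norm (H q) \<le> norm (H p) + r \<Longrightarrow> \<exists>\<sigma>. section_on (ball (H q) e) \<sigma> \<and> \<sigma> (H q) = q"
  obtains s' where "section_on (ball (H p) (r + e/4)) s'" "s' (H p) = p"
proof -
  define z0 where "z0 = H p"
  define d where "d = e/4"
  have d: "d > 0" using e by (simp add: d_def)
  have "\<exists>\<sigma>. section_on (ball u e) \<sigma> \<and> \<sigma> u = s u" if u: "u \<in> ball z0 r" for u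
  proof -
    have "H (s u) = u" using s(1) u by (simp add: section_on_def z0_def)
    moreover have "norm u \<le> norm z0 + r"
      using u norm_triangle_sub[of u z0] by (simp add: dist_norm norm_minus_commute)
    ultimately show ?thesis using sec[of "s u"] section_on_topspace[OF s(1)] u by (simp add: z0_def)
  qed
  then obtain \<sigma> where \<sigma>: "\<And>u. u \<in> ball z0 r \<Longrightarrow> section_on (ball u e) (\<sigma> u)" "\<And>u. u \<in> ball z0 r \<Longrightarrow> \<sigma> u u = s u"
    by metis
  \<comment> \<open>Uniqueness is applied twice: the branch at \<open>u0\<close> coincides with
    \<open>s\<close> as far as \<open>u1\<close>, so it meets the branch at \<open>u1\<close> there,
    and then both agree on the intersection of their balls.\<close>
  have agree: "\<sigma> u0 w = \<sigma> u1 w"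
    if u: "u0 \<in> ball z0 r" "u1 \<in> ball z0 r" "dist u0 u1 < e" and w: "w \<in> ball u0 e" "w \<in> ball u1 e" for u0 u1 w
  proof -
    have "\<sigma> u0 u1 = s u1"
    proof (rule section_unique[where T = "ball u0 e \<inter> ball z0 r" and ?w0.0 = u0])
      show "section_on (ball u0 e \<inter> ball z0 r) (\<sigma> u0)" using \<sigma>(1)[OF u(1)] section_on_subset by blast
      show "section_on (ball u0 e \<inter> ball z0 r) s" using s(1) section_on_subset z0_def by blast
      show "connected (ball u0 e \<inter> ball z0 r)" by (intro convex_connected convex_Int convex_ball)
    qed (use u e \<sigma>(2) in auto)
    then have eq: "\<sigma> u0 u1 = \<sigma> u1 u1" using \<sigma>(2)[OF u(2)] by simp
    show ?thesis
    proof (rule section_unique[where T = "ball u0 e \<inter> ball u1 e" and ?w0.0 = u1])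
      show "section_on (ball u0 e \<inter> ball u1 e) (\<sigma> u0)" using \<sigma>(1)[OF u(1)] section_on_subset by blast
      show "section_on (ball u0 e \<inter> ball u1 e) (\<sigma> u1)" using \<sigma>(1)[OF u(2)] section_on_subset by blast
      show "connected (ball u0 e \<inter> ball u1 e)" by (intro convex_connected convex_Int convex_ball)
    qed (use u e w eq in auto)
  qed
  let ?B = "ball z0 (r + d)"
  define \<rho> where "\<rho> w = z0 + (r / (r + d)) *\<^sub>R (w - z0)" for w
  have \<rho>_in: "\<rho> w \<in> ball z0 r" if "w \<in> ?B" for w
  proof -
    have "dist z0 (\<rho> w) = r / (r + d) * dist z0 w"
      using r d by (simp add: \<rho>_def dist_norm norm_minus_commute)
    also have "\<dots> < r / (r + d) * (r + d)" using that r d by (intro mult_strict_left_mono) auto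
    finally show ?thesis using r d by simp
  qed
  have \<rho>_near: "dist w (\<rho> w) < d" if "w \<in> ?B" for w
  proof -
    have "w - \<rho> w = (1 - r / (r + d)) *\<^sub>R (w - z0)" by (simp add: \<rho>_def algebra_simps)
    also have "1 - r / (r + d) = d / (r + d)" using r d by (simp add: field_simps)
    finally have "dist w (\<rho> w) = d / (r + d) * dist z0 w"
      using r d by (simp add: dist_norm norm_minus_commute)
    also have "\<dots> < d / (r + d) * (r + d)" using that r d by (intro mult_strict_left_mono) auto
    finally show ?thesis using r d by simp
  qed
  have \<rho>_contr: "dist (\<rho> w) (\<rho> w') \<le> dist w w'" for w w'
  proof -
    have "\<rho> w - \<rho> w' = (r / (r + d)) *\<^sub>R (w - w')" by (simp add: \<rho>_def algebra_simps)
    then have "dist (\<rho> w) (\<rho> w') = r / (r + d) * dist w w'" using r d by (simp add: dist_norm)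
    also have "\<dots> \<le> 1 * dist w w'" using r d by (intro mult_right_mono) auto
    finally show ?thesis by simp
  qed
  define s' where "s' w = \<sigma> (\<rho> w) w" for w
  \<comment> \<open>Near \<open>w\<close> one fixed branch suffices: \<open>\<rho>\<close> does not
    increase distances, so \<open>w1\<close> is within \<open>2 d + d < 4 d = e\<close> of
    \<open>\<rho> w\<close>.\<close>
  have loc: "s' w1 = \<sigma> (\<rho> w) w1" and ball: "w1 \<in> ball (\<rho> w) e"
    if "w \<in> ?B" "w1 \<in> ?B" "w1 \<in> ball w (2*d)" for w w1
  proof -
    have "dist (\<rho> w) w1 \<le> dist (\<rho> w) (\<rho> w1) + dist (\<rho> w1) w1" by (rule dist_triangle)
    also have "\<dots> < 2 * d + d"
      using \<rho>_contr[of w w1] \<rho>_near[OF that(2)] that(3) by (simp add: dist_commute)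
    finally show b: "w1 \<in> ball (\<rho> w) e" using d by (simp add: d_def)
    show "s' w1 = \<sigma> (\<rho> w) w1" unfolding s'_def
    proof (rule agree)
      show "dist (\<rho> w1) (\<rho> w) < e"
        using \<rho>_contr[of w w1] that(3) d by (simp add: d_def dist_commute)
      show "w1 \<in> ball (\<rho> w1) e" using \<rho>_near[OF that(2)] d by (simp add: d_def dist_commute)
    qed (use \<rho>_in that b in auto)
  qed
  have "continuous_map (top_of_set ?B) X s'"
  proof (rule pasting_lemma[where I = ?B and T = "\<lambda>w. ?B \<inter> ball w (2*d)" and f = "\<lambda>w. \<sigma> (\<rho> w)"])
    show "openin (top_of_set ?B) (?B \<inter> ball w (2 * d))" for w by (intro openin_open_Int) auto
    show "continuous_map (subtopology (top_of_set ?B) (?B \<inter> ball w (2 * d))) X (\<sigma> (\<rho> w))" if w: "w \<in> ?B" for w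
    proof -
      have "?B \<inter> ball w (2 * d) \<subseteq> ball (\<rho> w) e" using ball[OF w] by blast
      then have "section_on (?B \<inter> ball w (2 * d)) (\<sigma> (\<rho> w))"
        using \<sigma>(1)[OF \<rho>_in[OF w]] section_on_subset by blast
      then show ?thesis by (simp add: section_on_def subtopology_subtopology Int_absorb1 inf_assoc[symmetric])
    qed
    show "\<sigma> (\<rho> i) x = \<sigma> (\<rho> j) x"
      if "i \<in> ?B" "j \<in> ?B" "x \<in> topspace (top_of_set ?B) \<inter> (?B \<inter> ball i (2 * d)) \<inter> (?B \<inter> ball j (2 * d))" for i j x
      using loc[of i x] loc[of j x] that by auto
    show "\<exists>j. j \<in> ?B \<and> x \<in> ?B \<inter> ball j (2 * d) \<and> s' x = \<sigma> (\<rho> j) x" if "x \<in> topspace (top_of_set ?B)" for x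
      using that d unfolding s'_def by auto
  qed
  moreover have "H (s' w) = w" if w: "w \<in> ?B" for w
    using \<sigma>(1)[OF \<rho>_in[OF w]] ball[OF w w] d by (simp add: section_on_def s'_def)
  ultimately have "section_on ?B s'" by (simp add: section_on_def)
  moreover have "s' z0 = p" using \<sigma>(2)[of z0] r s(2) by (simp add: s'_def \<rho>_def z0_def)
  ultimately show ?thesis using that unfolding z0_def d_def by blast
qed

text \<open>The radius \<open>e\<close> is uniform over all values that can occur, so finitely many
  extensions by \<open>e/4\<close> reach any \<open>R\<close>.\<close>

lemma section_on_ball:
  assumes p: "p \<in> topspace X" and R: "R > 0"
  obtains s where "section_on (ball (H p) R) s" "s (H p) = p"
proof -
  obtain e where e: "e > 0"
    and sec: "\<And>q. q \<in> topspace X \<Longrightarrow> norm (H q) \<le> norm (H p) + R \<Longrightarrow> \<exists>\<sigma>. section_on (ball (H q) e) \<sigma> \<and> \<sigma> (H q) = q"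
    using uniform_section by blast
  \<comment> \<open>Capping at \<open>R\<close> keeps every intermediate ball in the range in which
    \<open>sec\<close> applies.\<close>
  have "\<exists>s. section_on (ball (H p) (min R (e + real n * (e/4)))) s \<and> s (H p) = p" for n
  proof (induction n)
    case 0
    obtain \<sigma> where "section_on (ball (H p) e) \<sigma>" "\<sigma> (H p) = p" using sec[OF p] R by auto
    moreover have "ball (H p) (min R (e + real 0 * (e/4))) \<subseteq> ball (H p) e" by auto
    ultimately show ?case using section_on_subset by blast
  next
    case (Suc n)
    let ?r = "min R (e + real n * (e/4))"
    obtain s where s: "section_on (ball (H p) ?r) s" "s (H p) = p" using Suc by blast
    have "?r > 0" using R e by (simp add: add_pos_nonneg)
    then obtain s' where s': "section_on (ball (H p) (?r + e/4)) s'" "s' (H p) = p"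
    proof (rule extend_section[OF s _ e])
      fix q assume "q \<in> topspace X" "norm (H q) \<le> norm (H p) + ?r"
      then show "\<exists>\<sigma>. section_on (ball (H q) e) \<sigma> \<and> \<sigma> (H q) = q" by (intro sec) simp_all
    qed
    have "e + real (Suc n) * (e/4) = e + real n * (e/4) + e/4" by (simp add: field_simps)
    then have "min R (e + real (Suc n) * (e/4)) \<le> ?r + e/4" using e by simp
    then have "section_on (ball (H p) (min R (e + real (Suc n) * (e/4)))) s'"
      using s'(1) section_on_subset subset_ball by blast
    with s'(2) show ?case by blast
  qed
  moreover obtain n :: nat where "R < real n * (e/4)"
    using e reals_Archimedean3[of "e/4"] by auto
  then have "min R (e + real n * (e/4)) = R" using e by simp
  ultimately show ?thesis using that by metis
qed

lemma global_section:
  assumes p: "p \<in> topspace X"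
  obtains s where "section_on UNIV s" "s (H p) = p"
proof -
  have "\<exists>s. section_on (ball (H p) (real n + 1)) s \<and> s (H p) = p" for n :: nat
    using section_on_ball[OF p, of "real n + 1"] by fastforce
  then obtain S where S: "\<And>n::nat. section_on (ball (H p) (real n + 1)) (S n)" "\<And>n. S n (H p) = p"
    using choice[of "\<lambda>n s. section_on (ball (H p) (real n + 1)) s \<and> s (H p) = p"] by blast
  have mono: "S m w = S n w" if "m \<le> n" "w \<in> ball (H p) (real m + 1)" for m n w
  proof (rule section_unique[where T = "ball (H p) (real m + 1)" and ?w0.0 = "H p"])
    show "section_on (ball (H p) (real m + 1)) (S n)"
      using section_on_subset[OF S(1)[of n]] that(1) by (simp add: subset_ball)
  qed (use S that in auto)
  \<comment> \<open>An index whose ball contains \<open>w\<close>; the 1 added to the radius absorbs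
    the strictness of the open ball.\<close>
  define N where "N w = nat \<lceil>dist (H p) w\<rceil>" for w
  have N: "w \<in> ball (H p) (real (N w) + 1)" for w
    using real_nat_ceiling_ge[of "dist (H p) w"] unfolding N_def mem_ball by linarith
  have "continuous_map euclidean X (\<lambda>w. S (N w) w)"
  proof (rule pasting_lemma[where I = UNIV and T = "\<lambda>n. ball (H p) (real n + 1)" and f = S])
    show "continuous_map (subtopology euclidean (ball (H p) (real n + 1))) X (S n)" for n
      using S(1)[of n] by (simp add: section_on_def)
    show "S i x = S j x"
      if "x \<in> topspace euclidean \<inter> ball (H p) (real i + 1) \<inter> ball (H p) (real j + 1)" for i j x
    proof (cases "i \<le> j")
      case True
      then show ?thesis using mono that by blast
    next
      case False
      then show ?thesis using mono[of j i x] that by simp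
    qed
    show "\<exists>j. j \<in> UNIV \<and> x \<in> ball (H p) (real j + 1) \<and> S (N x) x = S j x" for x
      using N[of x] by blast
  qed simp
  moreover have "H (S (N w) w) = w" for w using S(1) N unfolding section_on_def by blast
  ultimately have "section_on UNIV (\<lambda>w. S (N w) w)" by (simp add: section_on_def)
  then show ?thesis using that[of "\<lambda>w. S (N w) w"] S(2) by simp
qed

text \<open>The global section gives surjectivity. The points where it also inverts \<open>H\<close>
  from the left form a closed set, open by local injectivity and containing \<open>p\<close>, so
  connectedness of \<open>X\<close> gives injectivity.\<close>

theorem bij_betw_UNIV: "bij_betw H (topspace X) UNIV"
proof -
  obtain p where p: "p \<in> topspace X" using nonempty by blast
  obtain s where s: "section_on UNIV s" "s (H p) = p" using global_section[OF p] .
  have sc: "continuous_map euclidean X s" and sH: "H (s w) = w" for w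
    using s(1) by (simp_all add: section_on_def)
  let ?E = "{q \<in> topspace X. (s \<circ> H) q = id q}"
  have cont: "continuous_map X X (s \<circ> H)" using continuous sc by (rule continuous_map_compose)
  have "closedin X ?E"
    by (rule closedin_continuous_maps_eq[OF Hausdorff cont]) simp
  moreover have "openin X ?E"
  proof (subst openin_subopen, intro ballI)
    fix q assume q: "q \<in> ?E"
    then obtain V where V: "openin X V" "q \<in> V" "inj_on H V" using local_section by blast
    let ?W = "{q' \<in> topspace X. (s \<circ> H) q' \<in> V} \<inter> V"
    have "openin X ?W" using openin_continuous_map_preimage[OF cont V(1)] V(1) by (rule openin_Int)
    moreover have "q \<in> ?W" using q V(2) by auto
    moreover have "?W \<subseteq> ?E"
    proof
      fix q' assume q': "q' \<in> ?W"
      then have "s (H q') = q'" using sH V(3) by (auto dest: inj_onD)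
      then show "q' \<in> ?E" using q' by simp
    qed
    ultimately show "\<exists>W. openin X W \<and> q \<in> W \<and> W \<subseteq> ?E" by blast
  qed
  ultimately have "?E = topspace X" using connected p s(2) unfolding connected_space_clopen_in by fastforce
  then have left: "s (H q) = q" if "q \<in> topspace X" for q using that by auto
  show ?thesis
  proof (rule bij_betw_byWitness[where f' = s])
    show "s ` UNIV \<subseteq> topspace X" using continuous_map_image_subset_topspace[OF sc] by simp
  qed (use left sH in auto)
qed

end

section \<open>Meromorphic functions near a point\<close>

text \<open>For nonnegative \<open>n\<close> the truncation by \<open>nat\<close> makes the
  right-hand side 1, so zeros and poles are treated by one bound.\<close>

lemma powi_le_inverse_power:
  fixes x :: real
  assumes "0 < x" "x \<le> 1"
  shows "x powi n \<le> inverse x ^ nat (- n)"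
proof (cases "n \<ge> 0")
  case True
  then show ?thesis using assms by (simp add: power_int_def power_le_one)
next
  case False
  then show ?thesis by (simp add: power_int_def)
qed

text \<open>Integrating radially, a pole of order \<open>k\<close> of \<open>h\<close> bounds \<open>F\<close> by a multiple of
  \<open>\<bar>w - z\<bar> ^ (-k)\<close>.\<close>

lemma not_essential_primitive:
  assumes r: "r > 0"
    and deriv: "\<And>w. w \<in> ball z r - {z} \<Longrightarrow> (F has_field_derivative h w) (at w)"
    and mero: "h meromorphic_on {z}"
    and nz: "\<And>w. w \<in> ball z r - {z} \<Longrightarrow> h w \<noteq> 0"
  shows "not_essential F z"
proof -
  have ev: "eventually (\<lambda>w. w \<in> ball z r - {z}) (at z)"
    using r eventually_at_ball' [of r z UNIV] by (auto elim: eventually_mono)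
  then have "\<exists>\<^sub>F w in at z. h w \<noteq> 0"
    using nz by (intro eventually_frequently) (auto elim: eventually_mono)
  with mero obtain r1 where r1: "r1 > 0" "zor_poly h z holomorphic_on cball z r1"
    "\<And>w. w \<in> cball z r1 - {z} \<Longrightarrow> h w = zor_poly h z w * (w - z) powi zorder h z"
    using zorder_exist[of h z] unfolding meromorphic_at_iff by blast
  define k where "k = nat (- zorder h z)"
  define \<rho> where "\<rho> = min (1/2) (min (r/2) r1)"
  have \<rho>: "0 < \<rho>" "\<rho> \<le> 1" "\<rho> < r" "\<rho> \<le> r1" using r r1(1) by (auto simp: \<rho>_def)
  have "compact (zor_poly h z ` cball z r1)"
    using r1(2) by (intro compact_continuous_image holomorphic_on_imp_continuous_on) auto
  then obtain B where B: "B > 0" "\<And>w. w \<in> cball z r1 \<Longrightarrow> norm (zor_poly h z w) \<le> B"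
    using compact_imp_bounded bounded_pos by (metis (no_types, lifting) imageI)
  have h_bound: "norm (h w) \<le> B * inverse (norm (w - z)) ^ k" if "w \<in> cball z \<rho> - {z}" for w
  proof -
    have w: "w \<in> cball z r1 - {z}" and "norm (w - z) \<le> 1" "norm (w - z) > 0"
      using that \<rho> by (auto simp: dist_norm norm_minus_commute)
    then have "norm (h w) \<le> B * norm (w - z) powi zorder h z"
      using B(2)[of w] r1(3)[OF w] by (simp add: norm_mult norm_power_int mult_right_mono)
    also have "\<dots> \<le> B * inverse (norm (w - z)) ^ k"
      unfolding k_def using B(1) \<open>norm (w - z) \<le> 1\<close> \<open>norm (w - z) > 0\<close>
      by (intro mult_left_mono powi_le_inverse_power) auto
    finally show ?thesis .
  qed
  have F_holo: "F holomorphic_on ball z r - {z}"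
    unfolding holomorphic_on_def field_differentiable_def
    using deriv has_field_derivative_at_within by blast
  moreover have "sphere z \<rho> \<subseteq> ball z r - {z}" using \<rho> by auto
  ultimately have "continuous_on (sphere z \<rho>) F"
    using continuous_on_subset holomorphic_on_imp_continuous_on by blast
  then have "compact (F ` sphere z \<rho>)" by (intro compact_continuous_image) auto
  then obtain M where M: "M > 0" "\<And>w. w \<in> sphere z \<rho> \<Longrightarrow> norm (F w) \<le> M"
    using compact_imp_bounded bounded_pos by (metis (no_types, lifting) imageI)
  have F_bound: "norm ((w - z) ^ k * F w) \<le> M + B" if w: "w \<in> ball z \<rho> - {z}" for w
  proof -
    define d where "d = norm (w - z)"
    have d: "0 < d" "d < \<rho>" using w by (auto simp: d_def dist_norm norm_minus_commute)
    \<comment> \<open>The radial projection of \<open>w\<close> to the circle of radius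
      \<open>\<rho>\<close>, on which \<open>F\<close> is bounded by \<open>M\<close>. On the
      connecting segment the distance to \<open>z\<close> is at least \<open>d\<close>, so the bound
      on \<open>h\<close> is worst at \<open>w\<close>.\<close>
    define u where "u = z + (\<rho> / d) *\<^sub>R (w - z)"
    have u: "u \<in> sphere z \<rho>" using d \<rho> by (simp add: u_def dist_norm d_def)
    have seg: "d \<le> norm (\<xi> - z) \<and> norm (\<xi> - z) \<le> \<rho>" if \<xi>: "\<xi> \<in> closed_segment w u" for \<xi>
    proof -
      obtain t where t: "0 \<le> t" "t \<le> 1" "\<xi> = (1 - t) *\<^sub>R w + t *\<^sub>R u" using \<xi> by (auto simp: closed_segment_def)
      have "\<xi> - z = ((1 - t) + t * (\<rho> / d)) *\<^sub>R (w - z)"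
        unfolding t(3) u_def by (simp add: algebra_simps)
      moreover have "0 \<le> (1 - t) + t * (\<rho> / d)" using t d by simp
      ultimately have "norm (\<xi> - z) = ((1 - t) + t * (\<rho> / d)) * d" by (simp only: norm_scaleR d_def abs_of_nonneg)
      also have "\<dots> = (1 - t) * d + t * \<rho>" using d by (simp add: field_simps)
      finally have *: "norm (\<xi> - z) = (1 - t) * d + t * \<rho>" .
      have "t * d \<le> t * \<rho>" "(1 - t) * d \<le> (1 - t) * \<rho>" using t d by (auto intro: mult_left_mono)
      then show ?thesis unfolding * by (simp add: algebra_simps)
    qed
    have "norm (F w - F u) \<le> (B * inverse d ^ k) * norm (w - u)"
    proof (rule field_differentiable_bound[where S = "closed_segment w u" and f' = h])
      fix \<xi> assume \<xi>: "\<xi> \<in> closed_segment w u"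
      then have in_ball: "\<xi> \<in> cball z \<rho> - {z}"
        using seg[OF \<xi>] d by (auto simp: dist_norm norm_minus_commute)
      then have "\<xi> \<in> ball z r - {z}" using \<rho> by auto
      then show "(F has_field_derivative h \<xi>) (at \<xi> within closed_segment w u)"
        using deriv has_field_derivative_at_within by blast
      have "inverse (norm (\<xi> - z)) ^ k \<le> inverse d ^ k"
        using seg[OF \<xi>] d by (intro power_mono le_imp_inverse_le) auto
      then show "norm (h \<xi>) \<le> B * inverse d ^ k"
        using h_bound[OF in_ball] B(1) by (meson less_imp_le mult_left_mono order_trans)
    qed auto
    also have "norm (w - u) \<le> 1"
    proof -
      have "w - u = (1 - \<rho> / d) *\<^sub>R (w - z)" by (simp add: u_def algebra_simps)
      then have "norm (w - u) = \<bar>1 - \<rho> / d\<bar> * d" by (simp add: d_def)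
      also have "\<dots> = \<rho> - d" using d by (simp add: abs_if field_simps)
      finally show ?thesis using d \<rho> by simp
    qed
    finally have "norm (F w - F u) \<le> B * inverse d ^ k"
      using B(1) d by (simp add: mult_left_le)
    then have "norm (F w) \<le> M + B * inverse d ^ k"
      using M(2)[OF u] norm_triangle_sub[of "F w" "F u"] by linarith
    then have "d ^ k * norm (F w) \<le> d ^ k * (M + B * inverse d ^ k)"
      using d by (intro mult_left_mono) auto
    also have "\<dots> = d ^ k * M + B" using d by (simp add: algebra_simps power_inverse)
    also have "\<dots> \<le> 1 * M + B"
      using d \<rho> M(1) by (intro add_right_mono mult_right_mono power_le_one) auto
    finally show ?thesis by (simp add: norm_mult norm_power d_def)
  qed
  have "F holomorphic_on ball z \<rho> - {z}"
    using F_holo by (rule holomorphic_on_subset) (use \<rho> in auto)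
  \<comment> \<open>After multiplication by the power, \<open>F\<close> is bounded and extends
    across \<open>z\<close>; dividing again leaves at worst a pole. A logarithmic term cannot occur,
    as \<open>F\<close> is single-valued on the punctured disc.\<close>
  then have "(\<lambda>w. (w - z) ^ k * F w) holomorphic_on ball z \<rho> - {z}" by (intro holomorphic_intros)
  moreover have "\<forall>\<^sub>F w in at z. norm ((w - z) ^ k * F w) \<le> M + B"
    using eventually_at_ball'[OF \<rho>(1), of z UNIV] by eventually_elim (use F_bound in auto)
  ultimately obtain G where G: "G holomorphic_on ball z \<rho>" "\<And>w. w \<in> ball z \<rho> - {z} \<Longrightarrow> G w = (w - z) ^ k * F w"
    using holomorphic_on_extend_bounded[of "\<lambda>w. (w - z) ^ k * F w" "ball z \<rho>" z] \<rho>(1) by auto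
  have "G analytic_on {z}" 
    unfolding analytic_at using G(1) \<rho>(1) by (intro exI[of _ "ball z \<rho>"]) simp
  then have "(\<lambda>w. G w / (w - z) ^ k) meromorphic_on {z}"
    by (intro meromorphic_intros analytic_on_imp_meromorphic_on)
  then have "not_essential (\<lambda>w. G w / (w - z) ^ k) z" by (simp add: meromorphic_at_iff)
  moreover have "\<forall>\<^sub>F w in at z. G w / (w - z) ^ k = F w"
    using eventually_at_ball'[OF \<rho>(1), of z UNIV] by eventually_elim (use G(2) in auto)
  ultimately show ?thesis using not_essential_cong[of "\<lambda>w. G w / (w - z) ^ k" F z z] by simp
qed

lemma bounded_near_if_not_pole:
  assumes "not_essential f z" "\<not> is_pole f z"
  obtains B e where "e > 0" "\<And>w. w \<in> ball z e - {z} \<Longrightarrow> norm (f w) \<le> B"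
proof -
  obtain c where "f \<midarrow>z\<rightarrow> c" using assms by (auto simp: not_essential_def)
  then have "\<forall>\<^sub>F w in at z. dist (f w) c < 1" by (rule tendstoD) simp
  then obtain e where e: "e > 0" "\<And>w. w \<noteq> z \<Longrightarrow> dist w z < e \<Longrightarrow> dist (f w) c < 1"
    unfolding eventually_at by auto
  have "norm (f w) \<le> norm c + 1" if "w \<in> ball z e - {z}" for w
    using e(2)[of w] that norm_triangle_sub[of "f w" c] by (auto simp: dist_norm norm_minus_commute)
  with e(1) that show ?thesis by blast
qed

text \<open>At a pole of order \<open>n\<close> the curve is chosen such that \<open>g\<close> equals \<open>1 / t ^ n\<close> along it,
  hence is real.\<close>

lemma curve_bounded_Im:
  assumes mero: "g meromorphic_on {z}" and S: "open S" "z \<in> S"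
  obtains e \<zeta> B where "e > 0" "\<zeta> holomorphic_on ball 0 e" "\<zeta> 0 = z" "\<zeta> ` ball 0 e \<subseteq> S"
    "\<And>t. t \<in> ball 0 e - {0} \<Longrightarrow> \<zeta> t \<noteq> z"
    "\<And>t. 0 < t \<Longrightarrow> t < e \<Longrightarrow> \<bar>Im (g (\<zeta> (complex_of_real t)))\<bar> \<le> B"
proof (cases "is_pole g z")
  case False
  obtain B e1 where e1: "e1 > 0" "\<And>w. w \<in> ball z e1 - {z} \<Longrightarrow> norm (g w) \<le> B"
    using bounded_near_if_not_pole mero False by (metis meromorphic_at_iff)
  obtain e2 where e2: "e2 > 0" "ball z e2 \<subseteq> S" using S openE by blast
  define e where "e = min e1 e2"
  show ?thesis
  proof (rule that[of e "\<lambda>t. z + t" B])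
    show "e > 0" using e1(1) e2(1) by (simp add: e_def)
    show "(\<lambda>t. z + t) holomorphic_on ball 0 e" by (intro holomorphic_intros)
    show "(+) z ` ball 0 e \<subseteq> S" using e2(2) by (auto simp: e_def dist_norm subset_iff)
    show "\<bar>Im (g (z + complex_of_real t))\<bar> \<le> B" if "0 < t" "t < e" for t
      using e1(2)[of "z + complex_of_real t"] abs_Im_le_cmod[of "g (z + complex_of_real t)"] that
      by (auto simp: e_def dist_norm)
  qed auto
next
  case True
  obtain r0 where r0: "r0 > 0" "g analytic_on ball z r0 - {z}"
    using mero by (auto simp: meromorphic_at_iff isolated_singularity_at_def)
  have "open (ball z r0 \<inter> S)" "z \<in> ball z r0 \<inter> S" using S r0(1) by auto
  moreover have "g holomorphic_on (ball z r0 \<inter> S) - {z}"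
    using r0(2) analytic_imp_holomorphic holomorphic_on_subset by (metis Diff_mono Int_lower1 order_refl)
  ultimately obtain r where n: "zorder g z < 0" and r: "r > 0" "cball z r \<subseteq> ball z r0 \<inter> S"
    "zor_poly g z holomorphic_on cball z r"
    and gz: "\<And>w. w \<in> cball z r - {z} \<Longrightarrow> g w = zor_poly g z w / (w - z) ^ nat (- zorder g z)"
    and nz: "\<And>w. w \<in> cball z r \<Longrightarrow> zor_poly g z w \<noteq> 0"
    using zorder_exist_pole[of g "ball z r0 \<inter> S" z] True r0 by (metis (no_types, lifting) Diff_iff singletonD)
  define n where "n = nat (- zorder g z)"
  have n0: "n > 0" using n by (simp add: n_def)
  have "zor_poly g z holomorphic_on ball z r" using r(3) holomorphic_on_subset ball_subset_cball by blast
  \<comment> \<open>The factor \<open>zor_poly g z\<close> has no zeros on the disc, hence a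
    logarithm and an \<open>n\<close>-th root. This yields a local coordinate
    \<open>\<kappa>\<close> in which \<open>g\<close> is \<open>1 / \<kappa>^n\<close>; its inverse
    on the positive reals is the curve.\<close>
  then obtain l where l: "l holomorphic_on ball z r" "\<And>w. w \<in> ball z r \<Longrightarrow> exp (l w) = zor_poly g z w"
    using holomorphic_logarithm_exists[of "ball z r" "zor_poly g z" z] nz r(1)
    by (metis (no_types, lifting) ball_subset_cball centre_in_ball convex_ball open_ball subsetD)
  define \<kappa> where "\<kappa> w = (w - z) * exp (- l w / of_nat n)" for w
  have \<kappa>_holo: "\<kappa> holomorphic_on ball z r" unfolding \<kappa>_def by (intro holomorphic_intros l(1)) (use n0 in auto)
  have \<kappa>_pow: "g w = 1 / \<kappa> w ^ n" if "w \<in> ball z r - {z}" for w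
  proof -
    have "exp (- l w / of_nat n) ^ n = exp (- l w)"
      using n0 by (simp add: exp_of_nat_mult[symmetric])
    then have "\<kappa> w ^ n = (w - z) ^ n / zor_poly g z w"
      using l(2)[of w] that by (simp add: \<kappa>_def power_mult_distrib exp_minus divide_simps)
    then show ?thesis using gz[of w] that by (simp add: n_def)
  qed
  have "(\<kappa> has_field_derivative exp (- l z / of_nat n)) (at z)"
  proof -
    have "l field_differentiable at z" using l(1) r(1) holomorphic_on_imp_differentiable_at by (metis centre_in_ball open_ball)
    then obtain l' where "(l has_field_derivative l') (at z)" by (auto simp: field_differentiable_def)
    then show ?thesis unfolding \<kappa>_def using n0 by (auto intro!: derivative_eq_intros)
  qed
  then have "deriv \<kappa> z \<noteq> 0" using DERIV_imp_deriv by fastforce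
  then obtain r2 where r2: "r2 > 0" "ball z r2 \<subseteq> ball z r" "inj_on \<kappa> (ball z r2)"
    using has_complex_derivative_locally_injective[OF \<kappa>_holo, of z] r(1) by (metis centre_in_ball open_ball)
  have \<kappa>_holo2: "\<kappa> holomorphic_on ball z r2" using \<kappa>_holo r2(2) holomorphic_on_subset by blast
  then obtain \<zeta> where \<zeta>: "\<zeta> holomorphic_on \<kappa> ` ball z r2" "\<And>w. w \<in> ball z r2 \<Longrightarrow> \<zeta> (\<kappa> w) = w"
    using holomorphic_has_inverse[OF _ open_ball r2(3)] by metis
  have "open (\<kappa> ` ball z r2)" using open_mapping_thm3[OF \<kappa>_holo2 open_ball r2(3)] .
  moreover have "0 \<in> \<kappa> ` ball z r2" using r2(1) by (intro image_eqI[of _ _ z]) (auto simp: \<kappa>_def)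
  ultimately obtain e where e: "e > 0" "ball 0 e \<subseteq> \<kappa> ` ball z r2" using openE by blast
  have \<kappa>z: "\<kappa> z = 0" by (simp add: \<kappa>_def)
  have inv: "\<zeta> t \<in> ball z r2 \<and> \<kappa> (\<zeta> t) = t" if "t \<in> ball 0 e" for t
    using that e(2) \<zeta>(2) by auto
  show ?thesis
  proof (rule that[of e \<zeta> 0])
    show "\<zeta> holomorphic_on ball 0 e" using \<zeta>(1) e(2) holomorphic_on_subset by blast
    show "\<zeta> 0 = z" using \<zeta>(2)[of z] r2(1) \<kappa>z by simp
    have "ball z r2 \<subseteq> S" using r2(2) r(2) by (meson Int_lower2 ball_subset_cball order_trans)
    then show "\<zeta> ` ball 0 e \<subseteq> S" using inv by (auto simp: image_subset_iff)
    show ne: "\<zeta> t \<noteq> z" if "t \<in> ball 0 e - {0}" for t using inv[of t] that \<kappa>z by auto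
    show "\<bar>Im (g (\<zeta> (complex_of_real t)))\<bar> \<le> 0" if "0 < t" "t < e" for t
    proof -
      have t: "complex_of_real t \<in> ball 0 e" using that by simp
      have "g (\<zeta> (complex_of_real t)) = 1 / complex_of_real t ^ n"
        using \<kappa>_pow[of "\<zeta> (complex_of_real t)"] inv[OF t] ne[of "complex_of_real t"] t r2(2) that by auto
      also have "\<dots> = complex_of_real (1 / t ^ n)" by simp
      finally show ?thesis by (simp only: Im_complex_of_real abs_zero order_refl)
    qed
  qed (fact e(1))
qed

section \<open>Charts and lengths of curves\<close>

lemma chart_inj_on: "topological_chart X c \<Longrightarrow> inj_on (snd c) (fst c)"
  unfolding topological_chart_def
  using homeomorphic_imp_injective_map openin_subset topspace_subtopology_subset by metis

lemma chart_inverse: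
  assumes "topological_chart X c"
  shows "q \<in> fst c \<Longrightarrow> inv_into (fst c) (snd c) (snd c q) = q"
    and "\<zeta> \<in> chart_image c \<Longrightarrow> snd c (inv_into (fst c) (snd c) \<zeta>) = \<zeta>"
    and "\<zeta> \<in> chart_image c \<Longrightarrow> inv_into (fst c) (snd c) \<zeta> \<in> fst c"
  using chart_inj_on[OF assms] by (auto simp: chart_image_def inv_into_into f_inv_into_f)

lemma chart_inverse_continuous:
  assumes c: "topological_chart X c"
  shows "continuous_map (top_of_set (chart_image c)) X (inv_into (fst c) (snd c))"
proof -
  have W: "topspace (subtopology X (fst c)) = fst c"
    using c openin_subset unfolding topological_chart_def by fastforce
  obtain g where g: "homeomorphic_maps (subtopology X (fst c)) (top_of_set (chart_image c)) (snd c) g"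
    using c unfolding topological_chart_def homeomorphic_map_maps by blast
  then have "continuous_map (top_of_set (chart_image c)) X g"
    unfolding homeomorphic_maps_def by (simp add: continuous_map_in_subtopology)
  moreover have "g \<zeta> = inv_into (fst c) (snd c) \<zeta>" if \<zeta>: "\<zeta> \<in> topspace (top_of_set (chart_image c))" for \<zeta>
  proof -
    obtain q where q: "q \<in> fst c" "\<zeta> = snd c q" using \<zeta> by (auto simp: chart_image_def)
    then show ?thesis using g W chart_inverse(1)[OF c q(1)] unfolding homeomorphic_maps_def by simp
  qed
  ultimately show ?thesis by (rule continuous_map_eq)
qed

lemma chart_open_image:
  assumes c: "topological_chart X c" and V: "openin X V"
  shows "open (snd c ` (fst c \<inter> V))"
proof -
  have "openin (subtopology X (fst c)) (fst c \<inter> V)"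
    using V by (metis inf_commute openin_subtopology)
  then have "openin (top_of_set (chart_image c)) (snd c ` (fst c \<inter> V))"
    using c unfolding topological_chart_def
    using homeomorphic_imp_open_map open_map_def by metis
  then show ?thesis using c openin_open_trans unfolding topological_chart_def by blast
qed

lemma chart_open_preimage:
  assumes c: "topological_chart X c" and S: "open S"
  shows "openin X {q \<in> fst c. snd c q \<in> S}"
proof -
  have W: "topspace (subtopology X (fst c)) = fst c"
    using c openin_subset unfolding topological_chart_def by fastforce
  have "continuous_map (subtopology X (fst c)) euclidean (snd c)"
    using c homeomorphic_imp_continuous_map continuous_map_into_fulltopology
    unfolding topological_chart_def by metis
  then have "openin (subtopology X (fst c)) {q \<in> fst c. snd c q \<in> S}"
    using openin_continuous_map_preimage[of "subtopology X (fst c)" euclidean "snd c" S] S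
    unfolding W by simp
  then show ?thesis using c openin_trans_full unfolding topological_chart_def by blast
qed

lemma open_overlap:
  assumes "topological_chart X c" "topological_chart X c'"
  shows "open (overlap c c')"
  unfolding overlap_def using assms chart_open_image unfolding topological_chart_def by blast

lemma overlap_iff:
  assumes "topological_chart X c"
  shows "\<zeta> \<in> overlap c c' \<longleftrightarrow> \<zeta> \<in> chart_image c \<and> inv_into (fst c) (snd c) \<zeta> \<in> fst c'"
  using chart_inverse[OF assms] unfolding overlap_def chart_image_def by (auto intro: rev_image_eqI)

lemma in_chart_transition:
  assumes "topological_chart X c" "topological_chart X c'" "\<zeta> \<in> overlap c c'"
  shows "in_chart x c \<zeta> = in_chart x c' (transition c c' \<zeta>)" "transition c c' \<zeta> \<in> chart_image c'"
  using assms chart_inverse(1)[OF assms(2)] overlap_iff[OF assms(1)]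
  by (auto simp: in_chart_def transition_def chart_image_def)

section \<open>Partial derivatives, the chain rule and change of chart\<close>

lemma smooth_on_planeD:
  assumes "smooth_on_plane f S"
  shows "\<zeta> \<in> S \<Longrightarrow> f differentiable (at \<zeta>)" "continuous_on S (partial_u f)" "continuous_on S (partial_v f)"
  using assms[unfolded smooth_on_plane_def, rule_format, of 1] by simp_all

lemma has_derivative_partials:
  assumes "f differentiable (at \<zeta>)"
  shows "(f has_derivative (\<lambda>w. Re w *\<^sub>R partial_u f \<zeta> + Im w *\<^sub>R partial_v f \<zeta>)) (at \<zeta>)"
proof -
  let ?D = "frechet_derivative f (at \<zeta>)"
  have D: "(f has_derivative ?D) (at \<zeta>)" using assms frechet_derivative_works by blast
  then have lin: "linear ?D" using has_derivative_linear by blast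
  have "?D w = Re w *\<^sub>R partial_u f \<zeta> + Im w *\<^sub>R partial_v f \<zeta>" for w
  proof -
    have "w = Re w *\<^sub>R 1 + Im w *\<^sub>R \<i>" by (simp add: complex_eq_iff)
    then have "?D w = ?D (Re w *\<^sub>R 1 + Im w *\<^sub>R \<i>)" by simp
    also have "\<dots> = Re w *\<^sub>R ?D 1 + Im w *\<^sub>R ?D \<i>"
      by (simp only: linear_add[OF lin] linear_scale[OF lin])
    finally show ?thesis by (simp add: partial_u_def partial_v_def)
  qed
  then have "?D = (\<lambda>w. Re w *\<^sub>R partial_u f \<zeta> + Im w *\<^sub>R partial_v f \<zeta>)" by auto
  with D show ?thesis by metis
qed

lemma partials_eqI:
  assumes "(f has_derivative D) (at \<zeta>)"
  shows "partial_u f \<zeta> = D 1" "partial_v f \<zeta> = D \<i>"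
  using frechet_derivative_at[OF assms] by (simp_all add: partial_u_def partial_v_def)

lemma has_vector_derivative_compose_partials:
  assumes f: "f differentiable (at (\<eta> t))" and \<eta>: "(\<eta> has_vector_derivative v) (at t)"
  shows "((\<lambda>t. f (\<eta> t)) has_vector_derivative (Re v *\<^sub>R partial_u f (\<eta> t) + Im v *\<^sub>R partial_v f (\<eta> t))) (at t)"
proof -
  have "((\<lambda>t. f (\<eta> t)) has_derivative (\<lambda>s. Re (s *\<^sub>R v) *\<^sub>R partial_u f (\<eta> t) + Im (s *\<^sub>R v) *\<^sub>R partial_v f (\<eta> t))) (at t)"
    using has_derivative_compose[OF \<eta>[unfolded has_vector_derivative_def] has_derivative_partials[OF f]] .
  then show ?thesis unfolding has_vector_derivative_def by (simp add: scaleR_add_right)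
qed

text \<open>Positive definiteness is only given in atlas charts, and an isothermal chart need not be
  one. It is carried over by the chain rule along a transition map, whose positive Jacobian forces a
  nonzero \<open>partial_u\<close>.\<close>

lemma spacelike_in_isothermal_chart:
  assumes M: "spacelike_surface M x" and c: "isothermal_chart M x c" and \<zeta>: "\<zeta> \<in> chart_image c"
  shows "in_chart x c differentiable (at \<zeta>)" "form_E (in_chart x c) \<zeta> > 0"
proof -
  define q where "q = inv_into (fst c) (snd c) \<zeta>"
  have tc: "topological_chart (topo M) c" using c by (simp add: isothermal_chart_def)
  have S: "topological_surface M" using M by (simp add: spacelike_surface_def oriented_smooth_surface_def)
  have q: "q \<in> fst c" using chart_inverse(3)[OF tc \<zeta>] by (simp add: q_def)
  then have "q \<in> topspace (topo M)" using tc openin_subset unfolding topological_chart_def by blast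
  then obtain c' where c': "c' \<in> atlas M" "q \<in> fst c'" using S unfolding topological_surface_def by blast
  have tc': "topological_chart (topo M) c'" using S c'(1) by (simp add: topological_surface_def)
  have ov: "\<zeta> \<in> overlap c c'" using overlap_iff[OF tc] \<zeta> c'(2) by (simp add: q_def)
  define f' \<tau> where "f' = in_chart x c'" and "\<tau> = transition c c'"
  have ost: "oriented_smooth_transition c c'" using c c'(1) by (simp add: isothermal_chart_def)
  then have \<tau>: "\<tau> differentiable (at \<zeta>)" and jac: "Im (cnj (partial_u \<tau> \<zeta>) * partial_v \<tau> \<zeta>) > 0"
    using smooth_on_planeD(1) ov unfolding oriented_smooth_transition_def \<tau>_def by blast+
  have im: "\<tau> \<zeta> \<in> chart_image c'" using in_chart_transition(2)[OF tc tc' ov] by (simp add: \<tau>_def)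
  have sm: "smooth_on_plane f' (chart_image c')"
    and pos: "\<And>a b :: real. (a, b) \<noteq> (0, 0) \<Longrightarrow>
      lorentz (a *\<^sub>R partial_u f' (\<tau> \<zeta>) + b *\<^sub>R partial_v f' (\<tau> \<zeta>)) (a *\<^sub>R partial_u f' (\<tau> \<zeta>) + b *\<^sub>R partial_v f' (\<tau> \<zeta>)) > 0"
    using M c'(1) im unfolding spacelike_surface_def f'_def Let_def by blast+
  let ?D = "\<lambda>w. Re w *\<^sub>R partial_u f' (\<tau> \<zeta>) + Im w *\<^sub>R partial_v f' (\<tau> \<zeta>)"
  have "((\<lambda>\<xi>. f' (\<tau> \<xi>)) has_derivative (\<lambda>w. ?D (Re w *\<^sub>R partial_u \<tau> \<zeta> + Im w *\<^sub>R partial_v \<tau> \<zeta>))) (at \<zeta>)"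
    using has_derivative_compose[OF has_derivative_partials[OF \<tau>] has_derivative_partials] smooth_on_planeD(1)[OF sm im] .
  moreover have "f' (\<tau> \<xi>) = in_chart x c \<xi>" if "\<xi> \<in> overlap c c'" for \<xi>
    using in_chart_transition(1)[OF tc tc' that, where x = x] by (simp add: f'_def \<tau>_def)
  ultimately have D: "(in_chart x c has_derivative (\<lambda>w. ?D (Re w *\<^sub>R partial_u \<tau> \<zeta> + Im w *\<^sub>R partial_v \<tau> \<zeta>))) (at \<zeta>)"
    using has_derivative_transform_within_open[OF _ open_overlap[OF tc tc'] ov] by blast
  then show "in_chart x c differentiable (at \<zeta>)" by (auto simp: differentiable_def)
  have "partial_u (in_chart x c) \<zeta> = ?D (partial_u \<tau> \<zeta>)" using partials_eqI(1)[OF D] by simp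
  moreover have "partial_u \<tau> \<zeta> \<noteq> 0" using jac by auto
  then have "(Re (partial_u \<tau> \<zeta>), Im (partial_u \<tau> \<zeta>)) \<noteq> (0, 0)" by (simp add: complex_eq_iff)
  ultimately show "form_E (in_chart x c) \<zeta> > 0" using pos unfolding form_E_def by metis
qed

section \<open>Upper and lower bounds for the induced distance\<close>

lemma lorentz_add_left: "lorentz (u + v) w = lorentz u w + lorentz v w"
  and lorentz_add_right: "lorentz w (u + v) = lorentz w u + lorentz w v"
  by (simp_all add: lorentz_def algebra_simps)

lemma lorentz_scaleR_left: "lorentz (r *\<^sub>R u) v = r * lorentz u v"
  and lorentz_scaleR_right: "lorentz u (r *\<^sub>R v) = r * lorentz u v"
  for u v :: "real ^ 4"
  by (simp_all add: lorentz_def algebra_simps)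

lemma lorentz_commute: "lorentz u v = lorentz v u"
  by (simp add: lorentz_def mult.commute)

text \<open>The curve itself is an admissible path, and in isothermal parameters its squared speed
  is \<open>form_E\<close> times the squared Euclidean speed. The parameter interval is open because
  the curve used later runs into a puncture at parameter 0.\<close>

lemma induced_dist_curve_le:
  assumes M: "spacelike_surface M x" and c: "isothermal_chart M x c"
    and \<sigma>: "\<And>t. 0 < t \<Longrightarrow> t < e \<Longrightarrow> \<sigma> t \<in> chart_image c"
    and \<sigma>': "\<And>t. 0 < t \<Longrightarrow> t < e \<Longrightarrow> (\<sigma> has_vector_derivative \<sigma>' t) (at t)"
    and cont: "continuous_on {0<..<e} \<sigma>'"
    and C: "C \<ge> 0" "\<And>t. 0 < t \<Longrightarrow> t < e \<Longrightarrow> form_E (in_chart x c) (\<sigma> t) * (norm (\<sigma>' t))\<^sup>2 \<le> C\<^sup>2"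
    and st: "s \<in> {0<..<e}" "t \<in> {0<..<e}"
  shows "induced_dist M x (inv_into (fst c) (snd c) (\<sigma> s)) (inv_into (fst c) (snd c) (\<sigma> t)) \<le> ennreal (C * \<bar>s - t\<bar>)"
proof -
  \<comment> \<open>Affine reparametrisation to the unit interval; it covers both orders of
    \<open>s\<close> and \<open>t\<close> and puts the factor \<open>|t - s|\<close> into the
    speed.\<close>
  define a where "a \<tau> = s + \<tau> * (t - s)" for \<tau> :: real
  define \<gamma> where "\<gamma> \<tau> = inv_into (fst c) (snd c) (\<sigma> (a \<tau>))" for \<tau>
  have tc: "topological_chart (topo M) c" using c by (simp add: isothermal_chart_def)
  have a: "a \<tau> \<in> {0<..<e}" if "\<tau> \<in> {0..1}" for \<tau>
  proof -
    have "a \<tau> = (1 - \<tau>) * s + \<tau> * t" by (simp add: a_def algebra_simps)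
    then have "a \<tau> \<in> {0<..<e}"
      using convexD_alt[of "{0<..<e}" s t \<tau>] st that by simp
    then show ?thesis .
  qed
  have \<sigma>a': "((\<lambda>\<tau>. \<sigma> (a \<tau>)) has_vector_derivative ((t - s) *\<^sub>R \<sigma>' (a \<tau>))) (at \<tau>)" if "\<tau> \<in> {0..1}" for \<tau>
  proof -
    have "(a has_vector_derivative (t - s)) (at \<tau>)"
      unfolding a_def has_real_derivative_iff_has_vector_derivative[symmetric]
      by (auto intro!: derivative_eq_intros)
    then show ?thesis using vector_diff_chain_at[of a "t - s" \<tau> \<sigma> "\<sigma>' (a \<tau>)"] \<sigma>'[of "a \<tau>"] a[OF that]
      by (simp add: o_def)
  qed
  have \<sigma>a: "\<sigma> (a \<tau>) \<in> chart_image c" if "\<tau> \<in> {0..1}" for \<tau> using \<sigma> a[OF that] by simp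
  have cont_\<sigma>a: "continuous_on {0..1} (\<lambda>\<tau>. \<sigma> (a \<tau>))"
    using \<sigma>a' has_vector_derivative_continuous continuous_at_imp_continuous_on by blast
  have cont_a: "continuous_on {0..1} a" unfolding a_def by (intro continuous_intros)
  have path: "pathin (topo M) \<gamma>"
  proof -
    have "continuous_map (top_of_set {0..1}) (top_of_set (chart_image c)) (\<lambda>\<tau>. \<sigma> (a \<tau>))"
      using cont_\<sigma>a \<sigma>a by (auto simp: continuous_map_in_subtopology)
    from continuous_map_compose[OF this chart_inverse_continuous[OF tc]]
    show ?thesis by (simp add: pathin_def \<gamma>_def[abs_def] o_def)
  qed
  \<comment> \<open>\<open>surface_path\<close> tests the path in atlas charts, so the curve has to
    be read through transition maps.\<close>
  have "surface_path M \<gamma>" unfolding surface_path_def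
  proof (intro conjI ballI allI impI path)
    fix c' l r assume c': "c' \<in> atlas M" and lr: "0 \<le> l \<and> l \<le> r \<and> r \<le> 1 \<and> \<gamma> ` {l..r} \<subseteq> fst c'"
    let ?\<tau> = "transition c c'"
    let ?D = "\<lambda>\<tau>. Re ((t - s) *\<^sub>R \<sigma>' (a \<tau>)) *\<^sub>R partial_u ?\<tau> (\<sigma> (a \<tau>)) + Im ((t - s) *\<^sub>R \<sigma>' (a \<tau>)) *\<^sub>R partial_v ?\<tau> (\<sigma> (a \<tau>))"
    have sm: "smooth_on_plane ?\<tau> (overlap c c')"
      using c c' by (simp add: isothermal_chart_def oriented_smooth_transition_def)
    have ov: "\<sigma> (a \<tau>) \<in> overlap c c'" if "\<tau> \<in> {l..r}" for \<tau>
      using overlap_iff[OF tc] \<sigma>a[of \<tau>] lr that by (auto simp: \<gamma>_def)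
    have "((\<lambda>\<tau>. ?\<tau> (\<sigma> (a \<tau>))) has_vector_derivative ?D \<tau>) (at \<tau>)" if \<tau>: "\<tau> \<in> {l..r}" for \<tau>
      by (rule has_vector_derivative_compose_partials[OF smooth_on_planeD(1)[OF sm ov[OF \<tau>]] \<sigma>a'])
        (use \<tau> lr in auto)
    moreover have "continuous_on {l..r} ?D"
    proof -
      have sub: "{l..r} \<subseteq> {0..1}" using lr by auto
      have 1: "continuous_on {l..r} (\<lambda>\<tau>. \<sigma>' (a \<tau>))"
        by (rule continuous_on_compose2[OF cont continuous_on_subset[OF cont_a sub]]) (use a sub in auto)
      have 2: "continuous_on {l..r} (\<lambda>\<tau>. partial_u ?\<tau> (\<sigma> (a \<tau>)))"
        by (rule continuous_on_compose2[OF smooth_on_planeD(2)[OF sm] continuous_on_subset[OF cont_\<sigma>a sub]]) (use ov in auto)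
      have 3: "continuous_on {l..r} (\<lambda>\<tau>. partial_v ?\<tau> (\<sigma> (a \<tau>)))"
        by (rule continuous_on_compose2[OF smooth_on_planeD(3)[OF sm] continuous_on_subset[OF cont_\<sigma>a sub]]) (use ov in auto)
      show ?thesis by (intro continuous_intros 1 2 3)
    qed
    ultimately have "(\<lambda>\<tau>. ?\<tau> (\<sigma> (a \<tau>))) C1_differentiable_on {l..r}"
      unfolding C1_differentiable_on_def by (intro exI[of _ ?D]) simp
    moreover have "snd c' \<circ> \<gamma> = (\<lambda>\<tau>. ?\<tau> (\<sigma> (a \<tau>)))"
      by (simp add: fun_eq_iff \<gamma>_def transition_def in_chart_def)
    ultimately have "(snd c' \<circ> \<gamma>) C1_differentiable_on {l..r}" by simp
    then show "(snd c' \<circ> \<gamma>) piecewise_C1_differentiable_on {l..r}"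
      by (rule C1_differentiable_imp_piecewise)
  qed
  moreover have "\<gamma> 0 = inv_into (fst c) (snd c) (\<sigma> s)" "\<gamma> 1 = inv_into (fst c) (snd c) (\<sigma> t)"
    by (simp_all add: \<gamma>_def a_def)
  ultimately have "induced_dist M x (inv_into (fst c) (snd c) (\<sigma> s)) (inv_into (fst c) (snd c) (\<sigma> t)) \<le> path_length x \<gamma>"
    unfolding induced_dist_def by (intro INF_lower) auto
  also have "path_length x \<gamma> \<le> (\<integral>\<^sup>+\<tau>\<in>{0..1::real}. ennreal (C * \<bar>s - t\<bar>) \<partial>lborel)"
    unfolding path_length_def
  proof (intro nn_integral_mono)
    fix \<tau> :: real
    let ?f = "in_chart x c"
    let ?w = "vector_derivative (x \<circ> \<gamma>) (at \<tau>)"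
    have "sqrt (lorentz ?w ?w) \<le> C * \<bar>s - t\<bar>" if \<tau>: "\<tau> \<in> {0..1}"
    proof -
      let ?v = "(t - s) *\<^sub>R \<sigma>' (a \<tau>)"
      have "x \<circ> \<gamma> = (\<lambda>\<tau>. ?f (\<sigma> (a \<tau>)))" by (simp add: fun_eq_iff \<gamma>_def in_chart_def)
      then have w: "?w = Re ?v *\<^sub>R partial_u ?f (\<sigma> (a \<tau>)) + Im ?v *\<^sub>R partial_v ?f (\<sigma> (a \<tau>))"
        using has_vector_derivative_compose_partials[OF spacelike_in_isothermal_chart(1)[OF M c \<sigma>a[OF \<tau>]] \<sigma>a'[OF \<tau>]]
        by (simp only: vector_derivative_at)
      have EFG: "form_E ?f (\<sigma> (a \<tau>)) = form_G ?f (\<sigma> (a \<tau>))" "form_F ?f (\<sigma> (a \<tau>)) = 0"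
        using c \<sigma>a[OF \<tau>] by (simp_all add: isothermal_chart_def)
      have "lorentz ?w ?w = (Re ?v)\<^sup>2 * form_E ?f (\<sigma> (a \<tau>)) + 2 * Re ?v * Im ?v * form_F ?f (\<sigma> (a \<tau>)) + (Im ?v)\<^sup>2 * form_G ?f (\<sigma> (a \<tau>))"
        unfolding w form_E_def form_F_def form_G_def
        by (simp only: lorentz_add_left lorentz_add_right lorentz_scaleR_left lorentz_scaleR_right
          lorentz_commute[of "partial_v ?f (\<sigma> (a \<tau>))" "partial_u ?f (\<sigma> (a \<tau>))"] power2_eq_square algebra_simps)
      also have "\<dots> = form_E ?f (\<sigma> (a \<tau>)) * (norm ?v)\<^sup>2"
        by (simp only: EFG cmod_power2) (simp add: algebra_simps EFG)
      also have "\<dots> = (t - s)\<^sup>2 * (form_E ?f (\<sigma> (a \<tau>)) * (norm (\<sigma>' (a \<tau>)))\<^sup>2)"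
        by (simp add: power_mult_distrib)
      also have "\<dots> \<le> (t - s)\<^sup>2 * C\<^sup>2" using C(2)[of "a \<tau>"] a[OF \<tau>] by (intro mult_left_mono) auto
      finally have "lorentz ?w ?w \<le> (C * \<bar>s - t\<bar>)\<^sup>2"
        by (simp add: power_mult_distrib power2_commute mult.commute)
      then show ?thesis using C(1) by (intro real_le_lsqrt) simp_all
    qed
    then show "ennreal (sqrt (lorentz ?w ?w)) * indicator {0..1} \<tau> \<le> ennreal (C * \<bar>s - t\<bar>) * indicator {0..1} \<tau>"
      by (auto simp: indicator_def intro: ennreal_leI)
  qed
  also have "\<dots> = ennreal (C * \<bar>s - t\<bar>)" by (simp add: nn_integral_cmult_indicator)
  finally show ?thesis .
qed

text \<open>The displacement is the integral of the derivative, and its norm is at most the integral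
  of the norm. \<open>G\<close> need only dominate where a derivative exists, so the induced speed
  can be inserted for it.\<close>

lemma piecewise_C1_length_ge:
  fixes \<eta> :: "real \<Rightarrow> 'a::euclidean_space" and G :: "real \<Rightarrow> ennreal"
  assumes \<eta>: "\<eta> piecewise_C1_differentiable_on {a..b}" and ab: "a \<le> b" and l: "l \<ge> 0"
    and G: "\<And>t v. a < t \<Longrightarrow> t < b \<Longrightarrow> (\<eta> has_vector_derivative v) (at t) \<Longrightarrow> ennreal (l * norm v) \<le> G t"
  shows "ennreal (l * norm (\<eta> b - \<eta> a)) \<le> (\<integral>\<^sup>+t\<in>{a..b}. G t \<partial>lborel)"
proof -
  obtain S D where S: "finite S" "continuous_on {a..b} \<eta>"
    and D: "\<And>t. t \<in> {a..b} - S \<Longrightarrow> (\<eta> has_vector_derivative D t) (at t)" "continuous_on ({a..b} - S) D"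
    using \<eta> unfolding piecewise_C1_differentiable_on_def C1_differentiable_on_def by blast
  define T where "T = {a<..<b} - S"
  \<comment> \<open>Cutting the derivative off outside the open set \<open>T\<close> makes it Borel
    measurable, whatever happens at the exceptional points.\<close>
  define g where "g t = indicator T t *\<^sub>R D t" for t
  have "open T" unfolding T_def using S(1) by (simp add: finite_imp_closed open_Diff)
  moreover have "continuous_on T D" by (rule continuous_on_subset[OF D(2)]) (auto simp: T_def)
  ultimately have meas: "g \<in> borel_measurable lborel"
    unfolding g_def measurable_lborel2 by (intro borel_measurable_continuous_on_indicator) auto
  have hk: "(g has_integral (\<eta> b - \<eta> a)) {a..b}"
    by (rule fundamental_theorem_of_calculus_interior_strong[OF S(1) ab _ S(2)])
      (use D(1) in \<open>auto simp: g_def T_def\<close>)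
  have "ennreal (norm (\<eta> b - \<eta> a)) \<le> (\<integral>\<^sup>+t. ennreal (norm (g t)) \<partial>lborel)"
  proof (cases "(\<integral>\<^sup>+t. ennreal (norm (g t)) \<partial>lborel) < \<infinity>")
    case True
    then have int: "integrable lborel g" using meas by (simp add: integrable_iff_bounded)
    have "(g has_integral (\<eta> b - \<eta> a)) UNIV"
      by (rule has_integral_on_superset[OF hk]) (auto simp: g_def T_def)
    then have "\<eta> b - \<eta> a = integral\<^sup>L lborel g"
      using has_integral_integral_lborel[OF int] has_integral_unique by blast
    then show ?thesis using integral_norm_bound_ennreal[OF int] by simp
  qed (simp add: not_less top_unique)
  then have "ennreal l * ennreal (norm (\<eta> b - \<eta> a)) \<le> ennreal l * (\<integral>\<^sup>+t. ennreal (norm (g t)) \<partial>lborel)"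
    by (rule mult_left_mono) simp
  also have "\<dots> = (\<integral>\<^sup>+t. ennreal l * ennreal (norm (g t)) \<partial>lborel)"
    using meas by (intro nn_integral_cmult[symmetric]) simp
  also have "\<dots> \<le> (\<integral>\<^sup>+t\<in>{a..b}. G t \<partial>lborel)"
  proof (intro nn_integral_mono)
    fix t
    show "ennreal l * ennreal (norm (g t)) \<le> G t * indicator {a..b} t"
    proof (cases "t \<in> T")
      case True
      then show ?thesis using G[of t "D t"] D(1)[of t] l by (simp add: g_def T_def ennreal_mult)
    qed (simp add: g_def)
  qed
  finally show ?thesis using l by (simp add: ennreal_mult)
qed

text \<open>Over the compact set of points of \<open>K\<close> and unit directions the quadratic
  form attains a positive minimum, and homogeneity extends the bound to all
  \<open>v\<close>.\<close>

lemma spacelike_lower_bound: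
  assumes M: "spacelike_surface M x" and c: "c \<in> atlas M" and K: "compact K" "K \<subseteq> chart_image c"
  obtains l where "l > 0"
    "\<And>\<zeta> v. \<zeta> \<in> K \<Longrightarrow> (let w = Re v *\<^sub>R partial_u (in_chart x c) \<zeta> + Im v *\<^sub>R partial_v (in_chart x c) \<zeta>
      in l * norm v \<le> sqrt (lorentz w w))"
proof (cases "K = {}")
  case True
  then show ?thesis using that[of 1] by simp
next
  case False
  define f where "f = in_chart x c"
  define w where "w v \<zeta> = Re v *\<^sub>R partial_u f \<zeta> + Im v *\<^sub>R partial_v f \<zeta>" for v \<zeta>
  define Q where "Q p = lorentz (w (snd p) (fst p)) (w (snd p) (fst p))" for p
  have sm: "smooth_on_plane f (chart_image c)" using M c by (simp add: spacelike_surface_def f_def)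
  have pos: "Q (\<zeta>, v) > 0" if "\<zeta> \<in> K" "v \<noteq> 0" for \<zeta> v
  proof -
    have "(Re v, Im v) \<noteq> (0, 0)" using that(2) by (simp add: complex_eq_iff)
    moreover have "\<zeta> \<in> chart_image c" using that(1) K(2) by blast
    ultimately show ?thesis using M c unfolding spacelike_surface_def Q_def w_def f_def Let_def by auto
  qed
  let ?S = "K \<times> sphere (0::complex) 1"
  have comp: "compact ?S" using K(1) by (intro compact_Times) auto
  have cu: "continuous_on ?S (\<lambda>p. partial_u f (fst p))" and cv: "continuous_on ?S (\<lambda>p. partial_v f (fst p))"
    using smooth_on_planeD(2,3)[OF sm] K(2)
    by (auto intro!: continuous_on_compose2[where f = fst] continuous_on_fst continuous_on_id)
  have "continuous_on ?S (\<lambda>p. w (snd p) (fst p))"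
    unfolding w_def by (intro continuous_intros cu cv)
  then have "continuous_on ?S Q"
    unfolding Q_def lorentz_def by (intro continuous_intros)
  moreover have "(1::complex) \<in> sphere 0 1" by simp
  then have "?S \<noteq> {}" using False by blast
  ultimately obtain p0 where p0: "p0 \<in> ?S" "\<And>p. p \<in> ?S \<Longrightarrow> Q p0 \<le> Q p"
    using continuous_attains_inf[OF comp] by metis
  have "fst p0 \<in> K" "norm (snd p0) = 1" using p0(1) by auto
  then have Q0: "Q p0 > 0" using pos[of "fst p0" "snd p0"] by fastforce
  show ?thesis
  proof (rule that[of "sqrt (Q p0)"])
    fix \<zeta> v assume \<zeta>: "\<zeta> \<in> K"
    have "sqrt (Q p0) * norm v \<le> sqrt (Q (\<zeta>, v))"
    proof (cases "v = 0")
      case True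
      then show ?thesis by (simp add: Q_def w_def lorentz_def)
    next
      case False
      have "w v \<zeta> = norm v *\<^sub>R w (v /\<^sub>R norm v) \<zeta>" 
        using False by (simp add: w_def scaleR_add_right mult.assoc[symmetric])
      then have "Q (\<zeta>, v) = (norm v)\<^sup>2 * Q (\<zeta>, v /\<^sub>R norm v)"
        by (simp add: Q_def lorentz_scaleR_left lorentz_scaleR_right power2_eq_square)
      moreover have "Q p0 \<le> Q (\<zeta>, v /\<^sub>R norm v)" using False \<zeta> by (intro p0(2)) auto
      ultimately have "sqrt ((norm v)\<^sup>2 * Q p0) \<le> sqrt (Q (\<zeta>, v))"
        by (simp add: mult_left_mono)
      then show ?thesis by (simp add: real_sqrt_mult mult.commute)
    qed
    then show "let w = Re v *\<^sub>R partial_u (in_chart x c) \<zeta> + Im v *\<^sub>R partial_v (in_chart x c) \<zeta>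
      in sqrt (Q p0) * norm v \<le> sqrt (lorentz w w)" by (simp add: Q_def w_def f_def Let_def)
  qed (use Q0 in simp)
qed

text \<open>A path from outside \<open>W\<close> to \<open>q\<close> has to cross a coordinate annulus around \<open>q\<close>, after the
  last time at which it lies outside a coordinate disc.\<close>

lemma induced_dist_lower_bound:
  assumes M: "spacelike_surface M x" and W: "openin (topo M) W" and q: "q \<in> W"
  obtains \<delta> where "\<delta> > 0" "\<And>p. p \<in> topspace (topo M) - W \<Longrightarrow> ennreal \<delta> \<le> induced_dist M x p q"
proof -
  have S: "topological_surface M" using M by (simp add: spacelike_surface_def oriented_smooth_surface_def)
  have qM: "q \<in> topspace (topo M)" using W q openin_subset by blast
  then obtain c where c: "c \<in> atlas M" "q \<in> fst c" using S unfolding topological_surface_def by blast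
  have tc: "topological_chart (topo M) c" using S c(1) by (simp add: topological_surface_def)
  define f where "f = in_chart x c"
  define \<zeta>0 where "\<zeta>0 = snd c q"
  have "open (snd c ` (fst c \<inter> W))" "\<zeta>0 \<in> snd c ` (fst c \<inter> W)"
    using chart_open_image[OF tc W] c(2) q by (auto simp: \<zeta>0_def)
  then obtain r where r: "r > 0" "cball \<zeta>0 r \<subseteq> snd c ` (fst c \<inter> W)" using open_contains_cball by blast
  then have K: "cball \<zeta>0 r \<subseteq> chart_image c" by (auto simp: chart_image_def)
  obtain l where l: "l > 0" "\<And>\<zeta> v. \<zeta> \<in> cball \<zeta>0 r \<Longrightarrow> (let w = Re v *\<^sub>R partial_u f \<zeta> + Im v *\<^sub>R partial_v f \<zeta>
      in l * norm v \<le> sqrt (lorentz w w))"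
    using spacelike_lower_bound[OF M c(1) compact_cball K] unfolding f_def by blast
  define B where "B = {p \<in> fst c. snd c p \<in> ball \<zeta>0 r}"
  define C where "C = {p \<in> fst c. snd c p \<in> cball \<zeta>0 r}"
  have B: "openin (topo M) B" unfolding B_def by (rule chart_open_preimage[OF tc open_ball])
  have BW: "B \<subseteq> W"
  proof
    fix p assume p: "p \<in> B"
    then have "snd c p \<in> snd c ` (fst c \<inter> W)"
      using r(2) ball_subset_cball unfolding B_def by blast
    then obtain p' where "p' \<in> fst c \<inter> W" "snd c p = snd c p'" by blast
    then show "p \<in> W" using p chart_inj_on[OF tc] unfolding B_def by (auto dest: inj_onD)
  qed
  \<comment> \<open>As the image of a closed disc, \<open>C\<close> is compact, hence closed in the
    Hausdorff space \<open>topo M\<close>. Thus the path is still in \<open>C\<close> at the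
    limiting time \<open>t0\<close>.\<close>
  have "C = inv_into (fst c) (snd c) ` cball \<zeta>0 r"
  proof
    show "C \<subseteq> inv_into (fst c) (snd c) ` cball \<zeta>0 r"
    proof
      fix p assume "p \<in> C"
      then show "p \<in> inv_into (fst c) (snd c) ` cball \<zeta>0 r"
        unfolding C_def using chart_inverse(1)[OF tc, of p] by (metis (mono_tags, lifting) imageI mem_Collect_eq)
    qed
    show "inv_into (fst c) (snd c) ` cball \<zeta>0 r \<subseteq> C"
      using K chart_inverse(2,3)[OF tc] unfolding C_def by (auto simp: subset_iff)
  qed
  moreover have "compactin (top_of_set (chart_image c)) (cball \<zeta>0 r)"
    using K by (simp add: compactin_subtopology)
  ultimately have "compactin (topo M) C" using image_compactin chart_inverse_continuous[OF tc] by metis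
  then have C: "closedin (topo M) C"
    using S compactin_imp_closedin unfolding topological_surface_def by blast
  show ?thesis
  proof (rule that[of "l * r"])
    show "l * r > 0" using l(1) r(1) by simp
    fix p assume p: "p \<in> topspace (topo M) - W"
    show "ennreal (l * r) \<le> induced_dist M x p q" unfolding induced_dist_def
    proof (rule INF_greatest)
      fix \<gamma> assume "\<gamma> \<in> {\<gamma>. surface_path M \<gamma> \<and> \<gamma> 0 = p \<and> \<gamma> 1 = q}"
      then have \<gamma>: "surface_path M \<gamma>" "\<gamma> 0 = p" "\<gamma> 1 = q" by auto
      have cont: "continuous_map (top_of_set {0..1}) (topo M) \<gamma>"
        using \<gamma>(1) by (simp add: surface_path_def pathin_def)
      define T where "T = {t \<in> {0..1}. \<gamma> t \<notin> B}"
      have "closedin (topo M) (topspace (topo M) - B)" using B by blast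
      from closedin_continuous_map_preimage[OF cont this]
      have "closedin (top_of_set {0..1}) {t \<in> {0..1}. \<gamma> t \<in> topspace (topo M) - B}" by simp
      moreover have "{t \<in> {0..1}. \<gamma> t \<in> topspace (topo M) - B} = T"
        using continuous_map_image_subset_topspace[OF cont] by (auto simp: T_def)
      ultimately have "closed T" using closedin_closed_trans by (metis closed_atLeastAtMost)
      moreover have "0 \<in> T" using p BW \<gamma>(2) by (auto simp: T_def)
      moreover have bdd: "bdd_above T" by (rule bdd_aboveI[of _ 1]) (simp add: T_def)
      ultimately have t0: "Sup T \<in> T" using closed_contains_Sup by blast
      define t0 where "t0 = Sup T"
      have t0T: "t0 \<in> {0..1}" "\<gamma> t0 \<notin> B" using t0 by (auto simp: T_def t0_def)
      have "q \<in> B" using c(2) r(1) by (simp add: B_def \<zeta>0_def)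
      then have "t0 < 1" using t0T \<gamma>(3) by (cases "t0 = 1") auto
      have after: "\<gamma> t \<in> B" if "t0 < t" "t \<le> 1" for t
      proof (rule ccontr)
        assume "\<gamma> t \<notin> B"
        then have "t \<in> T" using that t0T(1) by (simp add: T_def)
        then have "t \<le> t0" unfolding t0_def using bdd by (rule cSup_upper)
        then show False using that(1) by simp
      qed
      have "\<gamma> t0 \<in> C"
      proof -
        have "closedin (top_of_set {0..1}) {t \<in> {0..1}. \<gamma> t \<in> C}"
          using closedin_continuous_map_preimage[OF cont C] by simp
        then have cl: "closed {t \<in> {0..1}. \<gamma> t \<in> C}" using closedin_closed_trans by (metis closed_atLeastAtMost)
        have "{t0<..1} \<subseteq> {t \<in> {0..1}. \<gamma> t \<in> C}"
          using after t0T(1) by (force simp: B_def C_def)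
        then have "closure {t0<..1} \<subseteq> {t \<in> {0..1}. \<gamma> t \<in> C}" using cl closure_minimal by blast
        moreover have "t0 \<in> closure {t0<..1}" using \<open>t0 < 1\<close> by (simp add: closure_greaterThanAtMost)
        ultimately show ?thesis by blast
      qed
      \<comment> \<open>In the closed disc but not in the open one: at \<open>t0\<close> the path is
        on the boundary circle.\<close>
      then have bdry: "norm (snd c (\<gamma> t0) - \<zeta>0) = r"
        using t0T(2) unfolding B_def C_def by (auto simp: dist_norm norm_minus_commute)
      have in_C: "\<gamma> t \<in> C" if "t \<in> {t0..1}" for t
        using that after[of t] \<open>\<gamma> t0 \<in> C\<close> by (cases "t = t0") (auto simp: B_def C_def)
      then have "\<gamma> ` {t0..1} \<subseteq> fst c" by (auto simp: C_def)
      then have pc1: "(snd c \<circ> \<gamma>) piecewise_C1_differentiable_on {t0..1}"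
        using \<gamma>(1) c(1) t0T(1) \<open>t0 < 1\<close> unfolding surface_path_def by auto
      let ?G = "\<lambda>t. ennreal (sqrt (lorentz (vector_derivative (x \<circ> \<gamma>) (at t)) (vector_derivative (x \<circ> \<gamma>) (at t))))"
      have "ennreal (l * norm ((snd c \<circ> \<gamma>) 1 - (snd c \<circ> \<gamma>) t0)) \<le> (\<integral>\<^sup>+t\<in>{t0..1}. ?G t \<partial>lborel)"
      proof (rule piecewise_C1_length_ge[OF pc1])
        fix t v assume t: "t0 < t" "t < 1" and v: "((snd c \<circ> \<gamma>) has_vector_derivative v) (at t)"
        have \<zeta>: "snd c (\<gamma> t) \<in> cball \<zeta>0 r" using in_C[of t] t by (simp add: C_def)
        then have "f differentiable (at (snd c (\<gamma> t)))"
          using M c(1) K smooth_on_planeD(1) unfolding spacelike_surface_def f_def by blast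
        from has_vector_derivative_compose_partials[of f "snd c \<circ> \<gamma>" t, OF _ v] this
        have "((\<lambda>t. f (snd c (\<gamma> t))) has_vector_derivative
            Re v *\<^sub>R partial_u f (snd c (\<gamma> t)) + Im v *\<^sub>R partial_v f (snd c (\<gamma> t))) (at t)" by simp
        then have "((x \<circ> \<gamma>) has_vector_derivative
            Re v *\<^sub>R partial_u f (snd c (\<gamma> t)) + Im v *\<^sub>R partial_v f (snd c (\<gamma> t))) (at t)"
        proof (rule has_vector_derivative_transform_within_open)
          show "open {t0<..<1}" "t \<in> {t0<..<1}" using t by auto
          fix s assume "s \<in> {t0<..<1}"
          then have "\<gamma> s \<in> fst c" using in_C[of s] by (simp add: C_def)
          then show "f (snd c (\<gamma> s)) = (x \<circ> \<gamma>) s" by (simp add: f_def in_chart_def chart_inverse(1)[OF tc])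
        qed
        then have "vector_derivative (x \<circ> \<gamma>) (at t) =
            Re v *\<^sub>R partial_u f (snd c (\<gamma> t)) + Im v *\<^sub>R partial_v f (snd c (\<gamma> t))"
          by (rule vector_derivative_at)
        then show "ennreal (l * norm v) \<le> ?G t" using l(2)[OF \<zeta>, of v] by (simp add: Let_def ennreal_leI)
      qed (use \<open>t0 < 1\<close> l(1) in auto)
      moreover have "norm ((snd c \<circ> \<gamma>) 1 - (snd c \<circ> \<gamma>) t0) = r"
        using bdry \<gamma>(3) by (simp add: \<zeta>0_def norm_minus_commute)
      moreover have "(\<integral>\<^sup>+t\<in>{t0..1}. ?G t \<partial>lborel) \<le> path_length x \<gamma>"
        unfolding path_length_def using t0T(1)
        by (intro nn_integral_mono mult_left_mono) (auto simp: indicator_def)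
      ultimately show "ennreal (l * r) \<le> path_length x \<gamma>" by simp
    qed
  qed
qed

section \<open>The developing map of a parabolic surface\<close>

locale parabolic_surface =
  fixes M :: "'a surface" and x :: "'a \<Rightarrow> real ^ 4" and A :: "complex ^ 4"
    and L :: "real ^ 4 \<Rightarrow> real ^ 4" and c :: complex
  assumes spacelike: "spacelike_surface M x"
    and linear_L: "linear L"
    and lorentz_L: "\<And>u v. lorentz (L u) (L v) = lorentz u v"
    and Im_c: "Im c \<noteq> 0"
    and degenerate: "\<And>a b. lorentz A (\<chi> i. (complex_of_real (a$i) - \<i> * complex_of_real (b$i)) / 2) = 0
      \<Longrightarrow> Complex (L a $ 1) (- (L b $ 1)) = c * Complex (L a $ 3 + L a $ 4) (- (L b $ 3 + L b $ 4))"
    and gauss: "gauss_image M x \<subseteq> quadric_section A"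
begin

text \<open>In the frame \<open>L\<close> the form \<open>2 \<phi>\<close> has components \<open>phi_L 1, \<dots>, phi_L 4\<close>, and degeneracy reads
  \<open>phi_L 1 = c * h\<close> with \<open>h = phi_L 3 + phi_L 4\<close>.\<close>

definition phi_L :: "4 \<Rightarrow> 'a chart \<Rightarrow> complex \<Rightarrow> complex" where
  "phi_L j d \<zeta> = Complex (L (partial_u (in_chart x d) \<zeta>) $ j) (- (L (partial_v (in_chart x d) \<zeta>) $ j))"

definition h :: "'a chart \<Rightarrow> complex \<Rightarrow> complex" where
  "h d \<zeta> = phi_L 3 d \<zeta> + phi_L 4 d \<zeta>"

text \<open>The real-linear function \<open>H_lin\<close> is chosen such that \<open>H\<close> is a primitive of \<open>h dz\<close>: its real
  part is \<open>Re \<integral>h\<close>, and its imaginary part is recovered from \<open>Re \<integral>c h\<close>, as \<open>c\<close> is not real.\<close>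

definition H_lin :: "real ^ 4 \<Rightarrow> complex" where
  "H_lin u = Complex (L u $ 3 + L u $ 4) ((Re c * (L u $ 3 + L u $ 4) - L u $ 1) / Im c)"

definition H :: "'a \<Rightarrow> complex" where
  "H q = H_lin (x q)"

lemma linear_H_lin: "linear H_lin"
  by (rule linearI)
    (simp_all add: H_lin_def linear_add[OF linear_L] linear_scale[OF linear_L] complex_eq_iff
      add_divide_distrib diff_divide_distrib algebra_simps)

lemma topological_surface_M: "topological_surface M"
  using spacelike by (simp add: spacelike_surface_def oriented_smooth_surface_def)

lemma phi_L_1:
  assumes d: "isothermal_chart M x d" and \<zeta>: "\<zeta> \<in> chart_image d"
  shows "phi_L 1 d \<zeta> = c * h d \<zeta>"
proof -
  have td: "topological_chart (topo M) d" using d by (simp add: isothermal_chart_def)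
  define q where "q = inv_into (fst d) (snd d) \<zeta>"
  have q: "q \<in> fst d" "snd d q = \<zeta>" using chart_inverse(2,3)[OF td \<zeta>] by (simp_all add: q_def)
  have "vec.span {phi_coeff x d (snd d q)} \<in> gauss_image M x"
    unfolding gauss_image_def using d q(1) by blast
  then have "vec.span {phi_coeff x d \<zeta>} \<in> quadric_section A" using gauss q(2) by auto
  then have "lorentz A (phi_coeff x d \<zeta>) = 0"
    using vec.span_base[of "phi_coeff x d \<zeta>" "{phi_coeff x d \<zeta>}"] by (simp add: quadric_section_def)
  then have "Complex (L (partial_u (in_chart x d) \<zeta>) $ 1) (- (L (partial_v (in_chart x d) \<zeta>) $ 1)) =
    c * Complex (L (partial_u (in_chart x d) \<zeta>) $ 3 + L (partial_u (in_chart x d) \<zeta>) $ 4)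
      (- (L (partial_v (in_chart x d) \<zeta>) $ 3 + L (partial_v (in_chart x d) \<zeta>) $ 4))"
    using degenerate unfolding phi_coeff_def by blast
  moreover have "Complex (L (partial_u (in_chart x d) \<zeta>) $ 3 + L (partial_u (in_chart x d) \<zeta>) $ 4)
      (- (L (partial_v (in_chart x d) \<zeta>) $ 3 + L (partial_v (in_chart x d) \<zeta>) $ 4)) = h d \<zeta>"
    by (simp add: h_def phi_L_def complex_eq_iff)
  ultimately show ?thesis by (simp add: phi_L_def)
qed

lemma h_nonzero:
  assumes d: "isothermal_chart M x d" and \<zeta>: "\<zeta> \<in> chart_image d"
  shows "h d \<zeta> \<noteq> 0"
    and "form_E (in_chart x d) \<zeta> = (cmod (h d \<zeta>))\<^sup>2 * ((Im c)\<^sup>2 + (Im (phi_L 2 d \<zeta> / h d \<zeta>))\<^sup>2)"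
proof -
  let ?a = "L (partial_u (in_chart x d) \<zeta>)" and ?b = "L (partial_v (in_chart x d) \<zeta>)"
  have hC: "Complex (?a $ 3 + ?a $ 4) (- (?b $ 3 + ?b $ 4)) = h d \<zeta>"
    by (simp add: h_def phi_L_def complex_eq_iff)
  have ab: "lorentz ?a ?a = lorentz ?b ?b" "lorentz ?a ?b = 0"
    using d \<zeta> unfolding isothermal_chart_def form_E_def form_F_def form_G_def by (auto simp: lorentz_L)
  have E: "lorentz ?a ?a = form_E (in_chart x d) \<zeta>" by (simp add: lorentz_L form_E_def)
  have pos: "lorentz ?a ?a > 0" unfolding E by (rule spacelike_in_isothermal_chart(2)[OF spacelike d \<zeta>])
  have deg: "Complex (?a $ 1) (- (?b $ 1)) = c * Complex (?a $ 3 + ?a $ 4) (- (?b $ 3 + ?b $ 4))"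
    unfolding hC using phi_L_1[OF d \<zeta>] by (simp add: phi_L_def)
  show "h d \<zeta> \<noteq> 0"
    "form_E (in_chart x d) \<zeta> = (cmod (h d \<zeta>))\<^sup>2 * ((Im c)\<^sup>2 + (Im (phi_L 2 d \<zeta> / h d \<zeta>))\<^sup>2)"
    using parabolic_pointwise[OF ab pos deg] unfolding hC E phi_L_def by blast+
qed

text \<open>By \<open>phi_L_1\<close> the real-linear map \<open>H_lin\<close> takes the two partial
  derivatives of the surface to \<open>h\<close> and \<open>\<i> * h\<close>. These are the
  Cauchy-Riemann equations, so the real derivative of \<open>H\<close> is multiplication by
  \<open>h\<close>.\<close>

lemma H_deriv:
  assumes d: "isothermal_chart M x d" and \<zeta>: "\<zeta> \<in> chart_image d"
  shows "(in_chart H d has_field_derivative h d \<zeta>) (at \<zeta>)"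
proof -
  let ?f = "in_chart x d"
  let ?a = "L (partial_u ?f \<zeta>)" and ?b = "L (partial_v ?f \<zeta>)"
  have "bounded_linear H_lin" using linear_H_lin by (simp add: linear_conv_bounded_linear)
  then have "(H_lin has_derivative H_lin) (at (?f \<zeta>))" by (rule bounded_linear_imp_has_derivative)
  from has_derivative_compose[OF has_derivative_partials[OF spacelike_in_isothermal_chart(1)[OF spacelike d \<zeta>]] this]
  have D: "((\<lambda>\<xi>. H_lin (?f \<xi>)) has_derivative
      (\<lambda>w. H_lin (Re w *\<^sub>R partial_u ?f \<zeta> + Im w *\<^sub>R partial_v ?f \<zeta>))) (at \<zeta>)" .
  have "?a $ 1 = Re (c * h d \<zeta>)" "?b $ 1 = - Im (c * h d \<zeta>)"
    unfolding phi_L_1[OF d \<zeta>, symmetric] by (simp_all add: phi_L_def)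
  moreover have "?a $ 3 + ?a $ 4 = Re (h d \<zeta>)" "?b $ 3 + ?b $ 4 = - Im (h d \<zeta>)"
    by (simp_all add: h_def phi_L_def)
  ultimately have "H_lin (partial_u ?f \<zeta>) = h d \<zeta>" "H_lin (partial_v ?f \<zeta>) = \<i> * h d \<zeta>"
    unfolding H_lin_def using Im_c by (simp_all add: complex_eq_iff field_simps)
  then have "H_lin (Re w *\<^sub>R partial_u ?f \<zeta> + Im w *\<^sub>R partial_v ?f \<zeta>) = h d \<zeta> * w" for w
    by (simp add: linear_add[OF linear_H_lin] linear_scale[OF linear_H_lin] complex_eq_iff algebra_simps)
  with D have "((\<lambda>\<xi>. H_lin (?f \<xi>)) has_derivative (\<lambda>w. h d \<zeta> * w)) (at \<zeta>)" by simp
  then show ?thesis by (simp add: has_field_derivative_def in_chart_def[abs_def] H_def)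
qed

text \<open>Since \<open>h\<close> has no zeros, \<open>H\<close> has a holomorphic local inverse in
  the chart. The form of the statement is that of the assumption \<open>local_section\<close> on
  proper local homeomorphisms.\<close>

lemma H_local_section:
  assumes d: "isothermal_chart M x d" and q: "q \<in> fst d"
  shows "\<exists>V e \<sigma>. openin (topo M) V \<and> q \<in> V \<and> inj_on H V \<and> 0 < e \<and>
    continuous_map (top_of_set (ball (H q) e)) (topo M) \<sigma> \<and> (\<forall>w\<in>ball (H q) e. \<sigma> w \<in> V \<and> H (\<sigma> w) = w)"
proof -
  have td: "topological_chart (topo M) d" using d by (simp add: isothermal_chart_def)
  define F where "F = in_chart H d"
  define U where "U = chart_image d"
  have U: "open U" using td by (simp add: topological_chart_def U_def)
  have dF: "(F has_field_derivative h d \<zeta>) (at \<zeta>)" if "\<zeta> \<in> U" for \<zeta>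
    using H_deriv[OF d] that unfolding F_def U_def by blast
  then have holo: "F holomorphic_on U" using U by (auto simp: holomorphic_on_open)
  have \<zeta>0: "snd d q \<in> U" using q by (simp add: U_def chart_image_def)
  have "deriv F (snd d q) = h d (snd d q)" using dF[OF \<zeta>0] by (rule DERIV_imp_deriv)
  then have "deriv F (snd d q) \<noteq> 0" using h_nonzero(1)[OF d] \<zeta>0 by (simp add: U_def)
  then obtain r where r: "r > 0" "ball (snd d q) r \<subseteq> U" "inj_on F (ball (snd d q) r)"
    using has_complex_derivative_locally_injective[OF holo \<zeta>0 U] by blast
  let ?B = "ball (snd d q) r"
  have holo': "F holomorphic_on ?B" using holo r(2) by (rule holomorphic_on_subset)
  obtain g where g: "g holomorphic_on F ` ?B" "\<And>\<zeta>. \<zeta> \<in> ?B \<Longrightarrow> deriv F \<zeta> * deriv g (F \<zeta>) = 1"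
    "\<And>\<zeta>. \<zeta> \<in> ?B \<Longrightarrow> g (F \<zeta>) = \<zeta>"
    using holomorphic_has_inverse[OF holo' open_ball r(3)] by metis
  have FH: "F (snd d p) = H p" if "p \<in> fst d" for p
    using chart_inverse(1)[OF td that] by (simp add: F_def in_chart_def)
  have "open (F ` ?B)" using open_mapping_thm3[OF holo' open_ball r(3)] .
  moreover have "H q \<in> F ` ?B" using FH[OF q] r(1) by (metis centre_in_ball imageI)
  ultimately obtain e where e: "e > 0" "ball (H q) e \<subseteq> F ` ?B" using openE by blast
  define V where "V = {p \<in> fst d. snd d p \<in> ?B}"
  define \<sigma> where "\<sigma> w = inv_into (fst d) (snd d) (g w)" for w
  have inj: "inj_on H V"
  proof (rule inj_onI)
    fix p p' assume p: "p \<in> V" "p' \<in> V" "H p = H p'"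
    then have "F (snd d p) = F (snd d p')" by (simp add: V_def FH)
    then have "snd d p = snd d p'" using p r(3) by (auto simp: V_def dest: inj_onD)
    then show "p = p'" using p chart_inj_on[OF td] by (auto simp: V_def dest: inj_onD)
  qed
  have gB: "g w \<in> ?B \<and> F (g w) = w" if "w \<in> ball (H q) e" for w
    using e(2) g(3) that by fastforce
  have "continuous_map (top_of_set (ball (H q) e)) (topo M) \<sigma>"
  proof -
    have "continuous_on (ball (H q) e) g"
      using g(1) e(2) holomorphic_on_imp_continuous_on holomorphic_on_subset by blast
    then have "continuous_map (top_of_set (ball (H q) e)) (top_of_set (chart_image d)) g"
      using gB r(2) by (auto simp: continuous_map_in_subtopology U_def)
    from continuous_map_compose[OF this chart_inverse_continuous[OF td]]
    show ?thesis by (simp add: \<sigma>_def[abs_def] o_def)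
  qed
  moreover have "\<sigma> w \<in> V \<and> H (\<sigma> w) = w" if w: "w \<in> ball (H q) e" for w
  proof -
    have gU: "g w \<in> chart_image d" using gB[OF w] r(2) unfolding U_def by blast
    have "\<sigma> w \<in> fst d" "snd d (\<sigma> w) = g w" using chart_inverse(2,3)[OF td gU] by (simp_all add: \<sigma>_def)
    moreover have "H (\<sigma> w) = w" using FH[of "\<sigma> w"] calculation gB[OF w] by simp
    ultimately show ?thesis using gB[OF w] by (simp add: V_def)
  qed
  moreover have "openin (topo M) V" unfolding V_def by (rule chart_open_preimage[OF td open_ball])
  moreover have "q \<in> V" using q r(1) by (simp add: V_def)
  ultimately show ?thesis using inj e(1) by blast
qed

lemma H_continuous_chart:
  assumes d: "isothermal_chart M x d" and q: "q \<in> fst d" and S: "open S" "H q \<in> S"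
  shows "\<exists>W. openin (topo M) W \<and> q \<in> W \<and> H ` W \<subseteq> S"
proof -
  have td: "topological_chart (topo M) d" using d by (simp add: isothermal_chart_def)
  have "continuous_on (chart_image d) (in_chart H d)"
    using H_deriv[OF d] DERIV_isCont by (blast intro: continuous_at_imp_continuous_on)
  then have op: "open (chart_image d \<inter> in_chart H d -` S)"
    using S(1) td by (simp add: topological_chart_def continuous_open_preimage)
  let ?W = "{p \<in> fst d. snd d p \<in> chart_image d \<inter> in_chart H d -` S}"
  have H: "in_chart H d (snd d p) = H p" if "p \<in> fst d" for p
    using chart_inverse(1)[OF td that] by (simp add: in_chart_def)
  have "q \<in> ?W" using q S(2) H by (simp add: chart_image_def)
  moreover have "H ` ?W \<subseteq> S" using H by auto
  ultimately show ?thesis using chart_open_preimage[OF td op] by blast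
qed

lemma entire_graph_if_bij:
  assumes bij: "bij_betw H (topspace (topo M)) UNIV"
  shows "entire_graph_lightlike M x"
proof -
  \<comment> \<open>The value of \<open>H_lin\<close> on every vector whose image under
    \<open>L\<close> has first component \<open>u1\<close> and components 3 and 4 adding up to
    \<open>2 * u2\<close>, as they do on a graph.\<close>
  define \<kappa> where "\<kappa> u1 u2 = Complex (2 * u2) ((Re c * (2 * u2) - u1) / Im c)" for u1 u2 :: real
  define m where "m u1 u2 = inv_into (topspace (topo M)) H (\<kappa> u1 u2)" for u1 u2
  have m: "m u1 u2 \<in> topspace (topo M)" "H (m u1 u2) = \<kappa> u1 u2" for u1 u2
    using bij by (simp_all add: m_def bij_betw_def inv_into_into f_inv_into_f)
  have \<kappa>_iff: "H q = \<kappa> u1 u2 \<longleftrightarrow> L (x q) $ 1 = u1 \<and> L (x q) $ 3 + L (x q) $ 4 = 2 * u2" for q u1 u2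
    using Im_c by (auto simp: H_def H_lin_def \<kappa>_def complex_eq_iff)
  define F1 F2 where "F1 u1 u2 = L (x (m u1 u2)) $ 2"
    and "F2 u1 u2 = (L (x (m u1 u2)) $ 3 - L (x (m u1 u2)) $ 4) / 2" for u1 u2
  have graph: "L (x (m u1 u2)) = vector [u1, F1 u1 u2, u2 + F2 u1 u2, u2 - F2 u1 u2]" for u1 u2
    using m(2)[of u1 u2] unfolding \<kappa>_iff
    by (simp add: vec_eq_iff forall_4 vector_4 F1_def F2_def field_simps)
  have "bij_betw (L \<circ> x) (topspace (topo M))
      {vector [u1, F1 u1 u2, u2 + F2 u1 u2, u2 - F2 u1 u2] | u1 u2. True}"
  proof (intro bij_betw_imageI inj_onI)
    fix q q' assume q: "q \<in> topspace (topo M)" "q' \<in> topspace (topo M)" "(L \<circ> x) q = (L \<circ> x) q'"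
    then have "H q = H q'" by (simp add: H_def H_lin_def)
    then show "q = q'" using bij q by (auto simp: bij_betw_def dest: inj_onD)
  next
    have "(L \<circ> x) q \<in> {vector [u1, F1 u1 u2, u2 + F2 u1 u2, u2 - F2 u1 u2] | u1 u2. True}"
      if q: "q \<in> topspace (topo M)" for q
    proof -
      define u1 u2 where "u1 = L (x q) $ 1" and "u2 = (L (x q) $ 3 + L (x q) $ 4) / 2"
      have "H q = H (m u1 u2)" unfolding m(2) \<kappa>_iff by (simp add: u1_def u2_def)
      then have "q = m u1 u2" using bij q m(1) by (auto simp: bij_betw_def dest: inj_onD)
      then show ?thesis using graph[of u1 u2] by auto
    qed
    moreover have "vector [u1, F1 u1 u2, u2 + F2 u1 u2, u2 - F2 u1 u2] \<in> (L \<circ> x) ` topspace (topo M)" for u1 u2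
      using m(1)[of u1 u2] graph[of u1 u2] by (metis comp_apply imageI)
    ultimately show "(L \<circ> x) ` topspace (topo M) =
        {vector [u1, F1 u1 u2, u2 + F2 u1 u2, u2 - F2 u1 u2] | u1 u2. True}" by blast
  qed
  moreover have "lorentz_isometry L"
    unfolding lorentz_isometry_def using linear_L lorentz_L by (intro exI[of _ L] exI[of _ 0]) simp
  ultimately show ?thesis unfolding entire_graph_lightlike_def by blast
qed

end

section \<open>Behaviour at the punctures\<close>

locale algebraic_parabolic_surface = parabolic_surface +
  fixes N :: "'b surface" and P :: "'b set" and \<psi> :: "'b \<Rightarrow> 'a"
    and \<omega> :: "'b chart \<Rightarrow> complex \<Rightarrow> complex ^ 4"
  assumes complete: "complete_surface M x"
    and compact: "compact_riemann_surface N"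
    and finite_P: "finite P"
    and P_subset: "P \<subseteq> topspace (topo N)"
    and conformal: "conformal_equivalence N P \<psi> M x"
    and mero: "meromorphic_form N \<omega>"
    and omega: "\<And>d \<zeta>. d \<in> atlas N \<Longrightarrow> \<zeta> \<in> snd d ` (fst d - P) \<Longrightarrow> \<omega> d \<zeta> = phi_coeff x (push_chart N P \<psi> d) \<zeta>"
begin

abbreviation pushed :: "'b chart \<Rightarrow> 'a chart" where
  "pushed d \<equiv> push_chart N P \<psi> d"

abbreviation N0 :: "'b set" where
  "N0 \<equiv> topspace (topo N) - P"

lemma topological_surface_N: "topological_surface N"
  using compact by (simp add: compact_riemann_surface_def riemann_surface_def)

lemma chart_N: "d \<in> atlas N \<Longrightarrow> topological_chart (topo N) d"
  using topological_surface_N by (simp add: topological_surface_def)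

lemma chart_N_subset: "d \<in> atlas N \<Longrightarrow> fst d \<subseteq> topspace (topo N)"
  using chart_N openin_subset unfolding topological_chart_def by blast

lemma openin_N_Diff_finite: "Q \<subseteq> P \<Longrightarrow> openin (topo N) (topspace (topo N) - Q)"
  using topological_surface_N finite_P P_subset closedin_Hausdorff_finite[of "topo N" Q]
  unfolding topological_surface_def by (metis finite_subset openin_diff openin_topspace order_trans)

lemma homeo: "homeomorphic_map (subtopology (topo N) N0) (topo M) \<psi>"
  using conformal by (simp add: conformal_equivalence_def)

lemma topspace_N0: "topspace (subtopology (topo N) N0) = N0"
  by auto

lemma inj_psi: "inj_on \<psi> N0"
  using homeomorphic_imp_injective_map[OF homeo] unfolding topspace_N0 .

lemma psi_image: "\<psi> ` N0 = topspace (topo M)"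
  using homeomorphic_imp_surjective_map[OF homeo] unfolding topspace_N0 .

lemma isothermal_pushed: "d \<in> atlas N \<Longrightarrow> isothermal_chart M x (pushed d)"
  using conformal by (simp add: conformal_equivalence_def)

lemma pushed_simps:
  assumes d: "d \<in> atlas N"
  shows "fst (pushed d) = \<psi> ` (fst d - P)"
    and "q \<in> fst d - P \<Longrightarrow> snd (pushed d) (\<psi> q) = snd d q"
    and "chart_image (pushed d) = snd d ` (fst d - P)"
    and "q \<in> fst d - P \<Longrightarrow> inv_into (fst (pushed d)) (snd (pushed d)) (snd d q) = \<psi> q"
proof -
  show 1: "fst (pushed d) = \<psi> ` (fst d - P)" by (simp add: push_chart_def)
  show 2: "snd (pushed d) (\<psi> q) = snd d q" if "q \<in> fst d - P" for q
  proof -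
    have "q \<in> N0" using that chart_N_subset[OF d] by blast
    then show ?thesis by (simp add: push_chart_def inv_into_f_f[OF inj_psi])
  qed
  show "chart_image (pushed d) = snd d ` (fst d - P)"
    unfolding chart_image_def 1 image_image using 2 by (intro image_cong) auto
  have td: "topological_chart (topo M) (pushed d)"
    using isothermal_pushed[OF d] by (simp add: isothermal_chart_def)
  show "inv_into (fst (pushed d)) (snd (pushed d)) (snd d q) = \<psi> q" if q: "q \<in> fst d - P"
    using chart_inverse(1)[OF td, of "\<psi> q"] 1 2[OF q] q by auto
qed

text \<open>Atlas charts of \<open>M\<close> need not be isothermal; the charts pushed forward from
  \<open>N\<close> supply isothermal ones everywhere.\<close>

lemma isothermal_cover:
  assumes q: "q \<in> topspace (topo M)"
  obtains d where "d \<in> atlas N" "isothermal_chart M x (pushed d)" "q \<in> fst (pushed d)"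
proof -
  obtain q' where q': "q' \<in> N0" "q = \<psi> q'" using q psi_image by blast
  then obtain d where d: "d \<in> atlas N" "q' \<in> fst d"
    using topological_surface_N unfolding topological_surface_def by blast
  then show ?thesis using that isothermal_pushed q' pushed_simps(1)[OF d(1)] by blast
qed

text \<open>The meromorphic extension of \<open>phi_L j\<close> across the punctures.\<close>

definition omega_L :: "4 \<Rightarrow> 'b chart \<Rightarrow> complex \<Rightarrow> complex" where
  "omega_L j d \<zeta> = 2 * (\<Sum>i\<in>UNIV. complex_of_real (L (axis i 1) $ j) * \<omega> d \<zeta> $ i)"

lemma omega_L_meromorphic:
  assumes "d \<in> atlas N" "\<zeta> \<in> chart_image d"
  shows "omega_L j d meromorphic_on {\<zeta>}"
proof -
  have "(\<lambda>\<zeta>. \<omega> d \<zeta> $ i) meromorphic_on {\<zeta>}" for i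
    using mero assms meromorphic_on_subset[of _ "chart_image d" "{\<zeta>}"] unfolding meromorphic_form_def by blast
  then show ?thesis unfolding omega_L_def[abs_def] by (intro meromorphic_intros)
qed

text \<open>The real matrix of \<open>L\<close> acts separately on real and imaginary parts, and the
  factor 2 in \<open>omega_L\<close> undoes the division by 2 in \<open>phi_coeff\<close>.\<close>

lemma omega_L_eq:
  assumes d: "d \<in> atlas N" and \<zeta>: "\<zeta> \<in> chart_image (pushed d)"
  shows "omega_L j d \<zeta> = phi_L j (pushed d) \<zeta>"
proof -
  have expand: "L u $ j = (\<Sum>i\<in>UNIV. u $ i * L (axis i 1) $ j)" for u
  proof -
    have "L u = L (\<Sum>i\<in>UNIV. u $ i *\<^sub>R axis i 1)"
      by (simp add: basis_expansion flip: scalar_mult_eq_scaleR)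
    also have "\<dots> = (\<Sum>i\<in>UNIV. u $ i *\<^sub>R L (axis i 1))"
      by (simp add: linear_sum[OF linear_L] linear_scale[OF linear_L])
    finally show ?thesis by simp
  qed
  have om: "\<omega> d \<zeta> = phi_coeff x (pushed d) \<zeta>" using omega[OF d] \<zeta> pushed_simps(3)[OF d] by simp
  define fu fv l where "fu = partial_u (in_chart x (pushed d)) \<zeta>"
    and "fv = partial_v (in_chart x (pushed d)) \<zeta>" and "l i = L (axis i 1) $ j" for i
  have "omega_L j d \<zeta> = (\<Sum>i\<in>UNIV. complex_of_real (l i) * (complex_of_real (fu $ i) - \<i> * complex_of_real (fv $ i)))"
    by (simp add: omega_L_def om phi_coeff_def fu_def fv_def l_def sum_distrib_left)
  also have "\<dots> = Complex (\<Sum>i\<in>UNIV. fu $ i * l i) (- (\<Sum>i\<in>UNIV. fv $ i * l i))"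
    by (simp add: complex_eq_iff sum_negf[symmetric] mult.commute)
  also have "\<dots> = phi_L j (pushed d) \<zeta>"
    unfolding l_def expand[symmetric] by (simp add: phi_L_def fu_def fv_def)
  finally show ?thesis .
qed

text \<open>The other punctures are finite in number and hence form a closed set, which a small disc
  about \<open>p\<close> avoids.\<close>

lemma puncture_neighbourhood:
  assumes d: "d \<in> atlas N" and p: "p \<in> fst d" "p \<in> P"
  obtains r where "r > 0" "ball (snd d p) r \<subseteq> chart_image d"
    "\<And>q. q \<in> fst d \<Longrightarrow> snd d q \<in> ball (snd d p) r - {snd d p} \<Longrightarrow> q \<notin> P"
    "ball (snd d p) r - {snd d p} \<subseteq> chart_image (pushed d)"
proof -
  let ?V = "topspace (topo N) - (P - {p})"
  have "open (snd d ` (fst d \<inter> ?V))"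
    by (intro chart_open_image[OF chart_N[OF d]] openin_N_Diff_finite) auto
  moreover have "snd d p \<in> snd d ` (fst d \<inter> ?V)" using p chart_N_subset[OF d] by auto
  ultimately obtain r where r: "r > 0" "ball (snd d p) r \<subseteq> snd d ` (fst d \<inter> ?V)" using openE by blast
  show ?thesis
  proof (rule that[of r])
    show "ball (snd d p) r \<subseteq> chart_image d" using r(2) by (auto simp: chart_image_def)
    show notP: "q \<notin> P" if q: "q \<in> fst d" "snd d q \<in> ball (snd d p) r - {snd d p}" for q
    proof -
      obtain q' where q': "q' \<in> fst d \<inter> ?V" "snd d q = snd d q'" using r(2) q(2) by blast
      then have "q = q'" using q(1) chart_inj_on[OF chart_N[OF d]] by (auto dest: inj_onD)
      then show ?thesis using q' q(2) by auto
    qed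
    show "ball (snd d p) r - {snd d p} \<subseteq> chart_image (pushed d)"
    proof
      fix \<zeta> assume \<zeta>: "\<zeta> \<in> ball (snd d p) r - {snd d p}"
      then obtain q where "q \<in> fst d" "\<zeta> = snd d q" using r(2) by blast
      then show "\<zeta> \<in> chart_image (pushed d)" using notP[of q] \<zeta> unfolding pushed_simps(3)[OF d] by blast
    qed
  qed (fact r(1))
qed

text \<open>If \<open>H\<close> had a removable singularity at a puncture, then \<open>h\<close> would be bounded there, and a
  curve running into the puncture along which \<open>Im (phi_L 2 / h)\<close> is bounded would have finite
  length, contradicting completeness.\<close>

lemma pole_at_puncture:
  assumes d: "d \<in> atlas N" and p: "p \<in> fst d" "p \<in> P"
  shows "is_pole (in_chart H (pushed d)) (snd d p)"
proof (rule ccontr)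
  assume no_pole: "\<not> is_pole (in_chart H (pushed d)) (snd d p)"
  define \<zeta>0 where "\<zeta>0 = snd d p"
  define F where "F = in_chart H (pushed d)"
  define h' where "h' \<zeta> = omega_L 3 d \<zeta> + omega_L 4 d \<zeta>" for \<zeta>
  have iso: "isothermal_chart M x (pushed d)" by (rule isothermal_pushed[OF d])
  have td: "topological_chart (topo N) d" by (rule chart_N[OF d])
  obtain r where r: "r > 0" "ball \<zeta>0 r \<subseteq> chart_image d"
    "ball \<zeta>0 r - {\<zeta>0} \<subseteq> chart_image (pushed d)"
    using puncture_neighbourhood[OF d p] unfolding \<zeta>0_def by metis
  have \<zeta>0: "\<zeta>0 \<in> chart_image d" using r(1,2) by auto
  have h': "h' \<zeta> = h (pushed d) \<zeta>" if "\<zeta> \<in> chart_image (pushed d)" for \<zeta>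
    using omega_L_eq[OF d that] by (simp add: h'_def h_def)
  have h'_mero: "h' meromorphic_on {\<zeta>0}"
    unfolding h'_def[abs_def] by (intro meromorphic_intros omega_L_meromorphic[OF d \<zeta>0])
  have dF: "(F has_field_derivative h' \<zeta>) (at \<zeta>)" if "\<zeta> \<in> ball \<zeta>0 r - {\<zeta>0}" for \<zeta>
    using H_deriv[OF iso, of \<zeta>] h'[of \<zeta>] r(3) that unfolding F_def by auto
  have "not_essential F \<zeta>0"
    using h_nonzero(1)[OF iso] h' r(3) by (intro not_essential_primitive[OF r(1) dF h'_mero]) auto
  then obtain c0 where "F \<midarrow>\<zeta>0\<rightarrow> c0" using no_pole by (auto simp: not_essential_def F_def \<zeta>0_def)
  \<comment> \<open>With a finite limit the singularity of \<open>F\<close> is removable, so its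
    derivative \<open>h'\<close> has a limit too and is bounded.\<close>
  then obtain c1 where "h' \<midarrow>\<zeta>0\<rightarrow> c1"
    using removable_singularity_deriv'[of F c0 \<zeta>0 "ball \<zeta>0 r" h'] dF r(1) by auto
  then have "not_essential h' \<zeta>0" "\<not> is_pole h' \<zeta>0"
    using not_tendsto_and_filterlim_at_infinity[of "at \<zeta>0" h' c1]
    by (auto simp: not_essential_def is_pole_def)
  then obtain Bh e1 where e1: "e1 > 0" "\<And>\<zeta>. \<zeta> \<in> ball \<zeta>0 e1 - {\<zeta>0} \<Longrightarrow> cmod (h' \<zeta>) \<le> Bh"
    using bounded_near_if_not_pole by metis
  \<comment> \<open>A bounded \<open>h'\<close> does not prevent \<open>g\<close> from having a pole
    here, which is why the approach curve has to be chosen.\<close>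
  define g where "g \<zeta> = omega_L 2 d \<zeta> / h' \<zeta>" for \<zeta>
  have "g meromorphic_on {\<zeta>0}"
    unfolding g_def[abs_def] by (intro meromorphic_intros omega_L_meromorphic[OF d \<zeta>0] h'_mero)
  moreover have "open (ball \<zeta>0 (min r e1))" "\<zeta>0 \<in> ball \<zeta>0 (min r e1)" using r(1) e1(1) by auto
  ultimately obtain e z B where e: "e > 0" and z: "z holomorphic_on ball 0 e" "z 0 = \<zeta>0"
    "z ` ball 0 e \<subseteq> ball \<zeta>0 (min r e1)" "\<And>t. t \<in> ball 0 e - {0} \<Longrightarrow> z t \<noteq> \<zeta>0"
    and B: "\<And>t. 0 < t \<Longrightarrow> t < e \<Longrightarrow> \<bar>Im (g (z (complex_of_real t)))\<bar> \<le> B"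
    by (rule curve_bounded_Im) blast
  define \<sigma> where "\<sigma> t = z (complex_of_real t)" for t
  define \<sigma>' where "\<sigma>' t = deriv z (complex_of_real t)" for t
  \<comment> \<open>A smaller closed disc is compact, so \<open>deriv z\<close>, and with it the
    Euclidean speed, is bounded there.\<close>
  define e' where "e' = e / 2"
  have e': "0 < e'" "e' < e" using e by (simp_all add: e'_def)
  have \<sigma>_in: "\<sigma> t \<in> ball \<zeta>0 (min r e1) - {\<zeta>0}" if "0 < t" "t < e" for t
    using z(3) z(4)[of "complex_of_real t"] that unfolding \<sigma>_def by (auto simp: image_subset_iff)
  have \<sigma>_chart: "\<sigma> t \<in> chart_image (pushed d)" if "0 < t" "t < e'" for t
    using \<sigma>_in[of t] r(3) that e' by auto
  have dz_holo: "deriv z holomorphic_on ball 0 e" using z(1) by (rule holomorphic_deriv) simp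
  have "cball 0 e' \<subseteq> ball (0::complex) e" using e' by auto
  then have "compact (deriv z ` cball 0 e')"
    using dz_holo by (intro compact_continuous_image continuous_on_subset[OF holomorphic_on_imp_continuous_on]) auto
  then obtain D where D: "D > 0" "\<And>t. t \<in> cball 0 e' \<Longrightarrow> cmod (deriv z t) \<le> D"
    using compact_imp_bounded bounded_pos by (metis (no_types, lifting) imageI)
  have \<sigma>'_deriv: "(\<sigma> has_vector_derivative \<sigma>' t) (at t)" if "0 < t" "t < e'" for t
  proof -
    have "(z has_field_derivative deriv z (complex_of_real t)) (at (complex_of_real t))"
      using holomorphic_derivI[OF z(1) open_ball] that e' by simp
    then show ?thesis unfolding \<sigma>_def[abs_def] \<sigma>'_def by (rule has_vector_derivative_real_field)
  qed
  have cont: "continuous_on {0<..<e'} \<sigma>'"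
    unfolding \<sigma>'_def
    by (rule continuous_on_compose2[OF holomorphic_on_imp_continuous_on[OF dz_holo]])
      (use e' in \<open>auto intro!: continuous_intros\<close>)
  \<comment> \<open>The product of the bounds on \<open>|h'|\<close>, on the square root of the
    other metric factor, and on the Euclidean speed.\<close>
  define C where "C = Bh * sqrt ((Im c)\<^sup>2 + B\<^sup>2) * D"
  have "cmod (h' (\<sigma> e')) \<le> Bh" using \<sigma>_in[OF e'] by (intro e1(2)) auto
  then have "Bh \<ge> 0" using norm_ge_zero order_trans by blast
  then have C0: "C \<ge> 0" using D(1) by (simp add: C_def)
  have speed: "form_E (in_chart x (pushed d)) (\<sigma> t) * (norm (\<sigma>' t))\<^sup>2 \<le> C\<^sup>2" if t: "0 < t" "t < e'" for t
  proof -
    note ch = \<sigma>_chart[OF t]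
    have te: "t < e" using t(2) e'(2) by simp
    have "form_E (in_chart x (pushed d)) (\<sigma> t) = (cmod (h' (\<sigma> t)))\<^sup>2 * ((Im c)\<^sup>2 + (Im (g (\<sigma> t)))\<^sup>2)"
      using h_nonzero(2)[OF iso ch] by (simp add: g_def h'[OF ch] omega_L_eq[OF d ch])
    also have "\<dots> \<le> Bh\<^sup>2 * ((Im c)\<^sup>2 + B\<^sup>2)"
    proof (intro mult_mono add_left_mono)
      show "(cmod (h' (\<sigma> t)))\<^sup>2 \<le> Bh\<^sup>2" using e1(2)[of "\<sigma> t"] \<sigma>_in[OF t(1) te] by (intro power_mono) auto
      show "(Im (g (\<sigma> t)))\<^sup>2 \<le> B\<^sup>2" using B[OF t(1) te] by (simp add: \<sigma>_def abs_le_square_iff[symmetric])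
    qed auto
    finally have "form_E (in_chart x (pushed d)) (\<sigma> t) * (norm (\<sigma>' t))\<^sup>2 \<le> (Bh\<^sup>2 * ((Im c)\<^sup>2 + B\<^sup>2)) * D\<^sup>2"
      using D(2)[of "complex_of_real t"] t by (intro mult_mono power_mono) (auto simp: \<sigma>'_def)
    also have "\<dots> = C\<^sup>2" by (simp add: C_def power_mult_distrib)
    finally show ?thesis .
  qed
  \<comment> \<open>The shift by 2 keeps \<open>t 0\<close> strictly below
    \<open>e'\<close>.\<close>
  define t where "t n = e' / (real n + 2)" for n :: nat
  have t: "0 < t n" "t n < e'" for n using e'(1) by (simp_all add: t_def divide_less_eq)
  have t_lim: "t \<longlonglongrightarrow> 0" unfolding t_def by real_asymp
  define s where "s n = inv_into (fst (pushed d)) (snd (pushed d)) (\<sigma> (t n))" for n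
  have dist_s: "induced_dist M x (s m) (s n) \<le> ennreal (C * \<bar>t m - t n\<bar>)" for m n
    unfolding s_def
    by (rule induced_dist_curve_le[OF spacelike iso \<sigma>_chart \<sigma>'_deriv cont C0 speed]) (use t in auto)
  define b where "b n = inv_into (fst d) (snd d) (\<sigma> (t n))" for n
  have b: "b n \<in> fst d - P" "snd d (b n) = \<sigma> (t n)" "s n = \<psi> (b n)" for n
  proof -
    obtain q where q: "q \<in> fst d - P" "\<sigma> (t n) = snd d q"
      using \<sigma>_chart[OF t, of n] unfolding pushed_simps(3)[OF d] by blast
    then have "b n = q" using chart_inverse(1)[OF td] by (simp add: b_def)
    then show "b n \<in> fst d - P" "snd d (b n) = \<sigma> (t n)" "s n = \<psi> (b n)"
      using q pushed_simps(4)[OF d q(1)] by (simp_all add: s_def)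
  qed
  have bN0: "b n \<in> N0" for n using b(1) chart_N_subset[OF d] by blast
  have sM: "s n \<in> topspace (topo M)" for n unfolding b(3) psi_image[symmetric] using bN0 by blast
  have "\<exists>K. \<forall>m\<ge>K. \<forall>n\<ge>K. induced_dist M x (s m) (s n) < \<epsilon>" if \<epsilon>: "\<epsilon> > 0" for \<epsilon> :: ennreal
  proof -
    obtain \<delta> where \<delta>: "\<delta> > 0" "ennreal \<delta> < \<epsilon>"
    proof (cases \<epsilon>)
      case (real a)
      then show ?thesis using \<epsilon> that[of "a/2"] by (simp add: ennreal_less_iff)
    qed (use that[of 1] in simp)
    have "(\<lambda>n. (C + 1) * t n) \<longlonglongrightarrow> (C + 1) * 0" by (intro tendsto_intros t_lim)
    then have "\<forall>\<^sub>F n in sequentially. (C + 1) * t n < \<delta>" using \<delta>(1) by (simp add: order_tendstoD(2))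
    then obtain K where K: "\<And>n. n \<ge> K \<Longrightarrow> (C + 1) * t n < \<delta>" unfolding eventually_sequentially by blast
    have "induced_dist M x (s m) (s n) < \<epsilon>" if "m \<ge> K" "n \<ge> K" for m n
    proof -
      have "\<bar>t m - t n\<bar> \<le> max (t m) (t n)" using t(1)[of m] t(1)[of n] by linarith
      then have "C * \<bar>t m - t n\<bar> \<le> C * max (t m) (t n)" using C0 by (rule mult_left_mono)
      also have "\<dots> \<le> (C + 1) * max (t m) (t n)" using t(1)[of m] by (intro mult_right_mono) auto
      also have "\<dots> < \<delta>" using K[OF that(1)] K[OF that(2)] by (simp add: max_def)
      finally have "ennreal (C * \<bar>t m - t n\<bar>) \<le> ennreal \<delta>" by (intro ennreal_leI) simp
      then show ?thesis using dist_s[of m n] \<delta>(2) by (meson le_less_trans order_trans)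
    qed
    then show ?thesis by blast
  qed
  then obtain q where q: "q \<in> topspace (topo M)" "(\<lambda>n. induced_dist M x (s n) q) \<longlonglongrightarrow> 0"
    using complete[unfolded complete_surface_def, rule_format, of s] sM by blast
  obtain q' where q': "q' \<in> N0" "q = \<psi> q'" using q(1) psi_image by blast
  have "p \<noteq> q'" "p \<in> topspace (topo N)" using p q'(1) chart_N_subset[OF d] by auto
  \<comment> \<open>In \<open>N\<close> the points \<open>b n\<close> tend to \<open>p\<close>,
    whereas the limit \<open>q\<close> comes from a point \<open>q'\<close> other than
    \<open>p\<close>. Separating the two puts \<open>s n\<close> eventually outside a neighbourhood
    of \<open>q\<close>, hence at least \<open>\<delta>\<close> away from it.\<close>
  then obtain U1 U2 where U: "openin (topo N) U1" "openin (topo N) U2" "p \<in> U1" "q' \<in> U2" "disjnt U1 U2"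
    using topological_surface_N q'(1) unfolding topological_surface_def Hausdorff_space_def by (metis DiffD1)
  define W where "W = \<psi> ` (U2 \<inter> N0)"
  have "openin (subtopology (topo N) N0) (U2 \<inter> N0)" using U(2) by (metis openin_subtopology)
  then have W: "openin (topo M) W"
    unfolding W_def using homeomorphic_imp_open_map[OF homeo] by (simp add: open_map_def)
  have qW: "q \<in> W" using q' U(4) by (auto simp: W_def)
  obtain \<delta> where \<delta>: "\<delta> > 0" "\<And>y. y \<in> topspace (topo M) - W \<Longrightarrow> ennreal \<delta> \<le> induced_dist M x y q"
    using induced_dist_lower_bound[OF spacelike W qW] by blast
  have "\<forall>\<^sub>F n in sequentially. s n \<in> topspace (topo M) - W"
  proof -
    have op: "open (snd d ` (fst d \<inter> U1))" "\<zeta>0 \<in> snd d ` (fst d \<inter> U1)"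
      using chart_open_image[OF td U(1)] p(1) U(3) by (auto simp: \<zeta>0_def)
    have "isCont z 0"
      using z(1) e holomorphic_on_imp_continuous_on continuous_on_interior by fastforce
    moreover have "(\<lambda>n. complex_of_real (t n)) \<longlonglongrightarrow> 0" using tendsto_of_real[OF t_lim] by simp
    ultimately have "(\<lambda>n. \<sigma> (t n)) \<longlonglongrightarrow> \<zeta>0"
      unfolding \<sigma>_def using isCont_tendsto_compose[of 0 z] z(2) by metis
    then have "\<forall>\<^sub>F n in sequentially. \<sigma> (t n) \<in> snd d ` (fst d \<inter> U1)" using op topological_tendstoD by blast
    then show ?thesis
    proof eventually_elim
      case (elim n)
      then obtain u where u: "u \<in> fst d \<inter> U1" "snd d (b n) = snd d u" using b(2) by auto
      then have "b n = u" using b(1)[of n] chart_inj_on[OF td] by (auto dest: inj_onD)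
      then have "b n \<in> U1" using u by simp
      moreover have "b n \<in> U2" if bW: "\<psi> (b n) \<in> W"
      proof -
        obtain y where "y \<in> U2 \<inter> N0" "\<psi> (b n) = \<psi> y" using bW by (auto simp: W_def)
        then show ?thesis using bN0[of n] inj_onD[OF inj_psi] by blast
      qed
      ultimately show ?case using sM[of n] U(5) unfolding b(3) disjnt_def by blast
    qed
  qed
  moreover have "\<forall>\<^sub>F n in sequentially. induced_dist M x (s n) q < ennreal \<delta>"
    using order_tendstoD(2)[OF q(2)] \<delta>(1) by simp
  ultimately have "\<forall>\<^sub>F n in sequentially. False"
  proof eventually_elim
    case (elim n)
    then show ?case using \<delta>(2)[of "s n"] by simp
  qed
  then show False by simp
qed

text \<open>Transported to the compact surface \<open>N\<close>, the set only has to be closed. At a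
  puncture its complement contains a whole disc because \<open>H\<close> has a pole there; elsewhere
  continuity of \<open>H\<close> suffices.\<close>

lemma compactin_H_bounded: "compactin (topo M) {q \<in> topspace (topo M). norm (H q) \<le> R}"
proof -
  define K where "K = {q \<in> N0. norm (H (\<psi> q)) \<le> R}"
  have KN: "K \<subseteq> topspace (topo N)" by (auto simp: K_def)
  have "openin (topo N) (topspace (topo N) - K)"
  proof (subst openin_subopen, intro ballI)
    fix y assume y: "y \<in> topspace (topo N) - K"
    then obtain d where d: "d \<in> atlas N" "y \<in> fst d"
      using topological_surface_N unfolding topological_surface_def by blast
    note td = chart_N[OF d(1)]
    show "\<exists>T. openin (topo N) T \<and> y \<in> T \<and> T \<subseteq> topspace (topo N) - K"
    proof (cases "y \<in> P")
      case True
      obtain r where r: "r > 0" "ball (snd d y) r \<subseteq> chart_image d"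
        "\<And>q. q \<in> fst d \<Longrightarrow> snd d q \<in> ball (snd d y) r - {snd d y} \<Longrightarrow> q \<notin> P"
        using puncture_neighbourhood[OF d True] by metis
      have "\<forall>\<^sub>F \<zeta> in at (snd d y). R < norm (in_chart H (pushed d) \<zeta>)"
        using filterlim_at_infinity_imp_norm_at_top[OF pole_at_puncture[OF d True, unfolded is_pole_def]]
        unfolding filterlim_at_top_dense by blast
      then obtain r' where r': "r' > 0"
        "\<And>\<zeta>. \<zeta> \<noteq> snd d y \<Longrightarrow> dist \<zeta> (snd d y) < r' \<Longrightarrow> R < norm (in_chart H (pushed d) \<zeta>)"
        unfolding eventually_at by auto
      let ?T = "{q \<in> fst d. snd d q \<in> ball (snd d y) (min r r')}"
      have "openin (topo N) ?T" by (rule chart_open_preimage[OF td open_ball])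
      moreover have "y \<in> ?T" using d r r' by simp
      moreover have "q \<notin> K" if q: "q \<in> ?T" for q
      proof (cases "snd d q = snd d y")
        case True
        then have "q = y" using q d chart_inj_on[OF td] by (auto dest: inj_onD)
        then show ?thesis using y by simp
      next
        case False
        then have "q \<notin> P" using r(3)[of q] q by auto
        then have "in_chart H (pushed d) (snd d q) = H (\<psi> q)"
          using pushed_simps(4)[OF d(1), of q] q by (simp add: in_chart_def)
        moreover have "R < norm (in_chart H (pushed d) (snd d q))"
          using r'(2)[OF False] q by (simp add: dist_commute)
        ultimately show ?thesis by (simp add: K_def)
      qed
      ultimately show ?thesis using chart_N_subset[OF d(1)] by blast
    next
      case False
      then have yN0: "y \<in> N0" and Hy: "H (\<psi> y) \<in> - cball 0 R" using y by (auto simp: K_def)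
      have iso: "isothermal_chart M x (pushed d)" by (rule isothermal_pushed[OF d(1)])
      have "\<psi> y \<in> fst (pushed d)" using d(2) False pushed_simps(1)[OF d(1)] by blast
      from H_continuous_chart[OF iso this _ Hy]
      obtain W where W: "openin (topo M) W" "\<psi> y \<in> W" "H ` W \<subseteq> - cball 0 R" by (auto simp: open_Compl)
      let ?T = "{q \<in> topspace (subtopology (topo N) N0). \<psi> q \<in> W}"
      have "openin (subtopology (topo N) N0) ?T"
        using homeomorphic_imp_continuous_map[OF homeo] W(1) by (rule openin_continuous_map_preimage)
      then have "openin (topo N) ?T" using openin_trans_full openin_N_Diff_finite[OF order_refl] by blast
      moreover have "y \<in> ?T" using yN0 W(2) by auto
      moreover have "?T \<subseteq> topspace (topo N) - K" using W(3) by (fastforce simp: K_def)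
      ultimately show ?thesis by blast
    qed
  qed
  then have "closedin (topo N) K" using KN by (simp add: closedin_def)
  then have "compactin (topo N) K"
    using compact closedin_compact_space unfolding compact_riemann_surface_def by blast
  then have "compactin (subtopology (topo N) N0) K" by (auto simp: compactin_subtopology K_def)
  then have "compactin (topo M) (\<psi> ` K)"
    using homeomorphic_imp_continuous_map[OF homeo] by (rule image_compactin)
  moreover have "\<psi> ` K = {q \<in> topspace (topo M). norm (H q) \<le> R}"
    unfolding psi_image[symmetric] K_def by auto
  ultimately show ?thesis by simp
qed

lemma entire_graph: "entire_graph_lightlike M x"
proof -
  have "proper_local_homeomorphism (topo M) H"
  proof
    show "Hausdorff_space (topo M)" "connected_space (topo M)" "topspace (topo M) \<noteq> {}"
      using topological_surface_M by (simp_all add: topological_surface_def)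
    show "continuous_map (topo M) euclidean H"
      unfolding continuous_map_def
    proof (intro conjI allI impI)
      fix S :: "complex set" assume "openin euclidean S"
      then have S: "open S" by simp
      show "openin (topo M) {q \<in> topspace (topo M). H q \<in> S}"
      proof (subst openin_subopen, intro ballI)
        fix q assume q: "q \<in> {q \<in> topspace (topo M). H q \<in> S}"
        then obtain d where "isothermal_chart M x (pushed d)" "q \<in> fst (pushed d)"
          using isothermal_cover by blast
        then obtain W where "openin (topo M) W" "q \<in> W" "H ` W \<subseteq> S"
          using H_continuous_chart S q by (metis (mono_tags, lifting) mem_Collect_eq)
        then show "\<exists>T. openin (topo M) T \<and> q \<in> T \<and> T \<subseteq> {q \<in> topspace (topo M). H q \<in> S}"
          using openin_subset by blast
      qed
    qed simp
    show "\<exists>V e \<sigma>. openin (topo M) V \<and> q \<in> V \<and> inj_on H V \<and> 0 < e \<and>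
        continuous_map (top_of_set (ball (H q) e)) (topo M) \<sigma> \<and> (\<forall>w\<in>ball (H q) e. \<sigma> w \<in> V \<and> H (\<sigma> w) = w)"
      if "q \<in> topspace (topo M)" for q
      using isothermal_cover[OF that] H_local_section by metis
    show "compactin (topo M) {q \<in> topspace (topo M). norm (H q) \<le> R}" for R
      by (rule compactin_H_bounded)
  qed
  then show ?thesis using proper_local_homeomorphism.bij_betw_UNIV entire_graph_if_bij by blast
qed

end

theorem theorem4p13:
  fixes M :: "'a surface" and x :: "'a \<Rightarrow> real ^ 4"
  assumes "stationary_surface M x"
    and "complete_surface M x"
    and "algebraic_surface TYPE('b) M x"
    and "degenerate_parabolic M x"
  shows "entire_graph_lightlike M x"
proof -
  obtain A where A: "Re_vec A \<noteq> Im_vec A" "independent {Re_vec A, Im_vec A}"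
    "lightlike_plane (span {Re_vec A, Im_vec A})" "gauss_image M x \<subseteq> quadric_section A"
    using assms(4) unfolding degenerate_parabolic_def by blast
  obtain N :: "'b surface" and P \<psi> \<omega> where N: "compact_riemann_surface N" "finite P"
    "P \<subseteq> topspace (topo N)" "conformal_equivalence N P \<psi> M x" "meromorphic_form N \<omega>"
    "\<forall>d\<in>atlas N. \<forall>\<zeta>\<in>snd d ` (fst d - P). \<omega> d \<zeta> = phi_coeff x (push_chart N P \<psi> d) \<zeta>"
    using assms(3) unfolding algebraic_surface_def by blast
  have "spacelike_surface M x" using assms(1) by (simp add: stationary_surface_def)
  show ?thesis
  proof (rule lightlike_frame[OF A(1-3)])
    fix L c
    assume "linear L" "\<And>u v. lorentz (L u) (L v) = lorentz u v" "Im c \<noteq> 0"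
      "\<And>a b. lorentz A (\<chi> i. (complex_of_real (a$i) - \<i> * complex_of_real (b$i)) / 2) = 0
        \<Longrightarrow> Complex (L a $ 1) (- (L b $ 1)) = c * Complex (L a $ 3 + L a $ 4) (- (L b $ 3 + L b $ 4))"
    with \<open>spacelike_surface M x\<close> A(4) have "parabolic_surface M x A L c"
      by (intro parabolic_surface.intro)
    moreover have "algebraic_parabolic_surface_axioms M x N P \<psi> \<omega>"
      using assms(2) N(1-5) N(6)[rule_format] by (rule algebraic_parabolic_surface_axioms.intro)
    ultimately interpret algebraic_parabolic_surface M x A L c N P \<psi> \<omega>
      by (rule algebraic_parabolic_surface.intro)
    show ?thesis by (rule entire_graph)
  qed
qed

end
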